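(* Let $K$ be a finite geometric simplicial complex with geometric realization $|K|$, let $\underline{\mathcal{A}}=\{\mathcal{A}_{\Delta}\}_{\Delta\in K}$ be a complex of Lie algebroids on $K$, and let $p\geq 0$. Then the sheaf $\mathfrak{S}$ on $|K|$ of the piecewise smooth forms of degree $p$ on the complex of Lie algebroids $\underline{\mathcal{A}}$ is fine.
   Context: All manifolds are smooth, finite-dimensional, possibly with boundaries of different indices (i.e. with corners). Simplex means closed simplex. $\Delta'\prec\Delta$ means that $\Delta'$ is a face of $\Delta$ (every simplex is a face of itself). A Lie algebroid on a manifold $M$ is a vector bundle $\mathcal{A}\to M$ with a vector bundle morphism $\rho:\mathcal{A}\to TM$ (anchor) and a real Lie algebra structure on $\Gamma(\mathcal{A})$ such that $\rho$ induces a Lie algebra homomorphism $\Gamma(\mathcal{A})\to\Gamma(TM)$ and $[\xi,f\eta]=f[\xi,\eta]+(\rho(\xi)\cdot f)\eta$ for $\xi,\eta\in\Gamma(\mathcal{A})$, $f\in C^{\infty}(M)$. It is transitive if $\rho$ is surjective. If $\mathcal{A}$ is transitive and $N\subset M$ is a submanifold (possibly with corners), the Lie algebroid restriction $\mathcal{A}^{!!}_{N}$ is the inverse image Lie algebroid of $\mathcal{A}$ along the inclusion; it is identified with the subbundle $\rho^{-1}(TN)$ of the vector bundle restriction $\mathcal{A}|_N$, and is a transitive Lie algebroid on $N$. A smooth form of degree $p$ on $\mathcal{A}$ is a smooth section of $\Lambda^p\mathcal{A}^*$; the space of these is $\Omega^{p}(\mathcal{A};M)$. The restriction $\omega_{/N}\in\Omega^p(\mathcal{A}^{!!}_N;N)$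 of $\omega\in\Omega^p(\mathcal{A};M)$ is its pullback along $\mathcal{A}^{!!}_N\to\mathcal{A}$. A complex of Lie algebroids on $K$ is a family $\underline{\mathcal{A}}=\{\mathcal{A}_{\Delta}\}_{\Delta\in K}$ where each $\mathcal{A}_{\Delta}$ is a transitive Lie algebroid on $\Delta$ and $(\mathcal{A}_{\Delta})^{!!}_{\Delta'}=\mathcal{A}_{\Delta'}$ whenever $\Delta'\prec\Delta$. For $a\in|K|$, $\Delta_a$ denotes the unique simplex of $K$ whose interior contains $a$. The generalized star $\mathrm{St}\,a$ is the union of the interiors of all simplices of $K$ containing $a$. A regular open neighborhood of $a$ is a set $U=Z\cap \mathrm{St}\,a$ with $Z$ an open neighborhood of $a$ in $|K|$; a regular open subset of $|K|$ is a regular open neighborhood of some point $a\in|K|$. For such $U$, and for $\Delta\in K$ with $\Delta_a\prec\Delta$, put $\Delta_U=U\cap\Delta$; the family $\underline{K}^U$ of all these manifolds $\Delta_U$ depends only on $U$. The derived complex is $\mathfrak{A}_U=\{(\mathcal{A}_{\Delta})^{!!}_{\Delta_U}:\Delta\in K,\ \Delta_a\prec\Delta\}$. The real vector space $\Omega^p_{ps}(\mathfrak{A}_U)$ consists of all families $\omega=(\omega_{\Delta_U})$ indexed by $\Delta_U\in\underline{K}^U$, with $\omega_{\Delta_U}\in\Omega^p((\mathcal{A}_{\Delta})^{!!}_{\Delta_U};\Delta_U)$, such that $\omega_{\Delta_U}$ and $\omega_{\Delta'_U}$ have the same restriction to $\Delta_U\cap\Delta'_U$ for all $\Delta_U,\Delta'_U\in\underline{K}^U$.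 If $V\subset U$ are regular open subsets, regular open neighborhoods of $b$ and $a$ respectively, then $\Delta_a\prec\Delta_b$, and the restriction $\omega_{/V}\in\Omega^p_{ps}(\mathfrak{A}_V)$ of $\omega\in\Omega^p_{ps}(\mathfrak{A}_U)$ is the family whose component at $\Delta_V$ (for $\Delta_b\prec\Delta$) is the restriction of $\omega_{\Delta_U}$ to $\Delta_V$. The regular open subsets form a base of the topology of $|K|$, and $U\mapsto\Omega^p_{ps}(\mathfrak{A}_U)$ with these restriction maps is a presheaf on this base. The sheaf of the piecewise smooth forms of degree $p$ on $\underline{\mathcal{A}}$ is the sheaf of real vector spaces on $|K|$ canonically associated with this presheaf (its sheafification, i.e. the sheaf of germs). A sheaf $\mathfrak{S}$ on $|K|$ is fine if for every locally finite open covering $\{U_j\}_{j\in J}$ of $|K|$ there are sheaf endomorphisms $h_j:\mathfrak{S}\to\mathfrak{S}$ ($j\in J$) such that the support of $h_j$ (the closure of the set of points $x$ at which the stalk map $(h_j)_x$ is nonzero) is contained in $U_j$ for each $j$, and $\sum_{j\in J}h_j=\mathrm{id}_{\mathfrak{S}}$. *)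

theory Defs
  imports "HOL-Analysis.Analysis" "HOL-Algebra.Module"
begin

text \<open>
  The only manifolds with corners that occur are the simplices of a geometric simplicial complex
  in a Euclidean space and (relatively) open subsets of them, with the smooth structure induced
  from the ambient space. They are represented as sets \<open>M :: 'a::euclidean_space set\<close>.
\<close>

primrec Ck_on :: "nat \<Rightarrow> 'a::euclidean_space set \<Rightarrow> ('a \<Rightarrow> 'b::real_normed_vector) \<Rightarrow> bool" where
  "Ck_on 0 S = (\<lambda>f. continuous_on S f)"
| "Ck_on (Suc k) S = (\<lambda>f. (\<forall>x\<in>S. f differentiable (at x)) \<and>
                          (\<forall>v. Ck_on k S (\<lambda>x. frechet_derivative f (at x) v)))"

definition smooth_on :: "'a::euclidean_space set \<Rightarrow> ('a \<Rightarrow> 'b::real_normed_vector) \<Rightarrow> bool" where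
  "smooth_on M f \<longleftrightarrow>
     (\<forall>x\<in>M. \<exists>G g. open G \<and> x \<in> G \<and> (\<forall>k. Ck_on k G g) \<and> (\<forall>y\<in>G \<inter> M. g y = f y))"

text \<open>
  A nonempty open subset of a simplex has the same affine hull as the simplex, and its tangent
  space at each point (boundary points included) is the direction space of that affine hull.
\<close>

definition tangent :: "'a::euclidean_space set \<Rightarrow> 'a \<Rightarrow> 'a set" where
  "tangent M x = span ((\<lambda>y. y - x) ` M)"

text \<open>
  A derivative within \<open>M\<close> of a smooth function is unique on \<^term>\<open>tangent M x\<close> (though in general
  not elsewhere), so \<^const>\<open>frechet_derivative\<close> gives well-defined values on tangent vectors.
\<close>

definition deriv_along ::
  "'a::euclidean_space set \<Rightarrow> ('a \<Rightarrow> 'b::real_normed_vector) \<Rightarrow> 'a \<Rightarrow> 'a \<Rightarrow> 'b" where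
  "deriv_along M f x v = frechet_derivative f (at x within M) v"

definition vf_bracket ::
  "'a::euclidean_space set \<Rightarrow> ('a \<Rightarrow> 'a) \<Rightarrow> ('a \<Rightarrow> 'a) \<Rightarrow> 'a \<Rightarrow> 'a" where
  "vf_bracket M X Y = (\<lambda>x. deriv_along M Y x (X x) - deriv_along M X x (Y x))"

text \<open>
  The fibres are arbitrary subsets of a type \<open>'e\<close> with their own vector space operations. A local
  trivialization \<open>(W, r, \<phi>)\<close> consists of an open subset \<open>W\<close> of the base, a rank \<open>r\<close> and linear
  isomorphisms \<open>\<phi> x\<close> from the fibres over \<open>x \<in> W\<close> onto \<open>\<real>\<^sup>r\<close>, the latter being realised as the
  sequences that vanish from index \<open>r\<close> on.
\<close>

record ('a, 'e) vbundle =
  base :: "'a set"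
  fibre :: "'a \<Rightarrow> 'e set"
  vzero :: "'a \<Rightarrow> 'e"
  vadd :: "'a \<Rightarrow> 'e \<Rightarrow> 'e \<Rightarrow> 'e"
  vscale :: "'a \<Rightarrow> real \<Rightarrow> 'e \<Rightarrow> 'e"
  trivs :: "('a set \<times> nat \<times> ('a \<Rightarrow> 'e \<Rightarrow> nat \<Rightarrow> real)) set"

definition coord_space :: "nat \<Rightarrow> (nat \<Rightarrow> real) set" where
  "coord_space r = {c. \<forall>i\<ge>r. c i = 0}"

definition linear_iso_coords ::
  "('a, 'e, 'm) vbundle_scheme \<Rightarrow> 'a \<Rightarrow> 'e set \<Rightarrow> nat \<Rightarrow> ('e \<Rightarrow> nat \<Rightarrow> real) \<Rightarrow> bool" where
  "linear_iso_coords E x F r f \<longleftrightarrow>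
     vzero E x \<in> F \<and>
     (\<forall>v\<in>F. \<forall>w\<in>F. vadd E x v w \<in> F) \<and>
     (\<forall>c. \<forall>v\<in>F. vscale E x c v \<in> F) \<and>
     bij_betw f F (coord_space r) \<and>
     f (vzero E x) = (\<lambda>i. 0) \<and>
     (\<forall>v\<in>F. \<forall>w\<in>F. f (vadd E x v w) = (\<lambda>i. f v i + f w i)) \<and>
     (\<forall>c. \<forall>v\<in>F. f (vscale E x c v) = (\<lambda>i. c * f v i))"

definition local_frame ::
  "('a, 'e, 'm) vbundle_scheme \<Rightarrow> ('a \<Rightarrow> 'e \<Rightarrow> nat \<Rightarrow> real) \<Rightarrow> nat \<Rightarrow> 'a \<Rightarrow> 'e" where
  "local_frame E \<phi> i x = inv_into (fibre E x) (\<phi> x) (\<lambda>j. if j = i then 1 else 0)"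

text \<open>
  The vector space axioms in the fibres are not listed: they are transported from \<open>\<real>\<^sup>r\<close> by the
  linear bijections \<open>\<phi> x\<close>.
\<close>

definition vector_bundle ::
  "'a::euclidean_space set \<Rightarrow> ('a, 'e, 'm) vbundle_scheme \<Rightarrow> bool" where
  "vector_bundle M E \<longleftrightarrow>
     base E = M \<and>
     (\<forall>(W, r, \<phi>) \<in> trivs E.
        openin (top_of_set M) W \<and> (\<forall>x\<in>W. linear_iso_coords E x (fibre E x) r (\<phi> x))) \<and>
     (\<forall>x\<in>M. \<exists>(W, r, \<phi>) \<in> trivs E. x \<in> W) \<and>
     (\<forall>(W, r, \<phi>) \<in> trivs E. \<forall>(W', r', \<phi>') \<in> trivs E. \<forall>i<r. \<forall>j<r'.
        smooth_on (W \<inter> W') (\<lambda>x. \<phi>' x (local_frame E \<phi> i x) j))"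

text \<open>
  Smooth sections over \<open>V\<close>. For a submanifold \<open>V\<close> of the base which is not open these are the
  smooth sections of the vector bundle restriction of \<open>E\<close> to \<open>V\<close>. Sections over \<open>V\<close> are
  extensional functions, so that equality of sections is equality of functions.
\<close>

definition smooth_sections ::
  "('a::euclidean_space, 'e, 'm) vbundle_scheme \<Rightarrow> 'a set \<Rightarrow> ('a \<Rightarrow> 'e) set" where
  "smooth_sections E V =
     {s \<in> (\<Pi>\<^sub>E x\<in>V. fibre E x).
        \<forall>(W, r, \<phi>) \<in> trivs E. \<forall>i<r. smooth_on (V \<inter> W) (\<lambda>x. \<phi> x (s x) i)}"

abbreviation global_sections ::
  "('a::euclidean_space, 'e, 'm) vbundle_scheme \<Rightarrow> ('a \<Rightarrow> 'e) set" where
  "global_sections E \<equiv> smooth_sections E (base E)"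

definition sec_zero :: "('a, 'e, 'm) vbundle_scheme \<Rightarrow> 'a \<Rightarrow> 'e" where
  "sec_zero E = (\<lambda>x\<in>base E. vzero E x)"

definition sec_add ::
  "('a, 'e, 'm) vbundle_scheme \<Rightarrow> ('a \<Rightarrow> 'e) \<Rightarrow> ('a \<Rightarrow> 'e) \<Rightarrow> 'a \<Rightarrow> 'e" where
  "sec_add E s t = (\<lambda>x\<in>base E. vadd E x (s x) (t x))"

definition sec_mult ::
  "('a, 'e, 'm) vbundle_scheme \<Rightarrow> ('a \<Rightarrow> real) \<Rightarrow> ('a \<Rightarrow> 'e) \<Rightarrow> 'a \<Rightarrow> 'e" where
  "sec_mult E f s = (\<lambda>x\<in>base E. vscale E x (f x) (s x))"

record ('a, 'e) algebroid = "('a, 'e) vbundle" +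
  anchor :: "'a \<Rightarrow> 'e \<Rightarrow> 'a"
  bracket :: "('a \<Rightarrow> 'e) \<Rightarrow> ('a \<Rightarrow> 'e) \<Rightarrow> 'a \<Rightarrow> 'e"

definition anchored ::
  "('a, 'e) algebroid \<Rightarrow> ('a \<Rightarrow> 'e) \<Rightarrow> 'a \<Rightarrow> 'a" where
  "anchored A s = (\<lambda>x. anchor A x (s x))"

definition anchor_morphism :: "('a::euclidean_space, 'e) algebroid \<Rightarrow> bool" where
  "anchor_morphism A \<longleftrightarrow>
     (\<forall>x\<in>base A.
        (\<forall>v\<in>fibre A x. anchor A x v \<in> tangent (base A) x) \<and>
        (\<forall>v\<in>fibre A x. \<forall>w\<in>fibre A x. anchor A x (vadd A x v w) = anchor A x v + anchor A x w) \<and>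
        (\<forall>c. \<forall>v\<in>fibre A x. anchor A x (vscale A x c v) = c *\<^sub>R anchor A x v)) \<and>
     (\<forall>V s. openin (top_of_set (base A)) V \<longrightarrow> s \<in> smooth_sections A V \<longrightarrow>
        smooth_on V (anchored A s))"

definition lie_algebra_on_sections :: "('a::euclidean_space, 'e) algebroid \<Rightarrow> bool" where
  "lie_algebra_on_sections A \<longleftrightarrow>
     (\<forall>\<xi>\<in>global_sections A. \<forall>\<eta>\<in>global_sections A. bracket A \<xi> \<eta> \<in> global_sections A) \<and>
     (\<forall>\<xi>\<in>global_sections A. \<forall>\<eta>\<in>global_sections A. \<forall>\<zeta>\<in>global_sections A.
        bracket A (sec_add A \<xi> \<eta>) \<zeta> = sec_add A (bracket A \<xi> \<zeta>) (bracket A \<eta> \<zeta>) \<and>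
        bracket A \<zeta> (sec_add A \<xi> \<eta>) = sec_add A (bracket A \<zeta> \<xi>) (bracket A \<zeta> \<eta>)) \<and>
     (\<forall>c. \<forall>\<xi>\<in>global_sections A. \<forall>\<eta>\<in>global_sections A.
        bracket A (sec_mult A (\<lambda>_. c) \<xi>) \<eta> = sec_mult A (\<lambda>_. c) (bracket A \<xi> \<eta>) \<and>
        bracket A \<xi> (sec_mult A (\<lambda>_. c) \<eta>) = sec_mult A (\<lambda>_. c) (bracket A \<xi> \<eta>)) \<and>
     (\<forall>\<xi>\<in>global_sections A. bracket A \<xi> \<xi> = sec_zero A) \<and>
     (\<forall>\<xi>\<in>global_sections A. \<forall>\<eta>\<in>global_sections A. \<forall>\<zeta>\<in>global_sections A.
        sec_add A (bracket A \<xi> (bracket A \<eta> \<zeta>))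
          (sec_add A (bracket A \<eta> (bracket A \<zeta> \<xi>)) (bracket A \<zeta> (bracket A \<xi> \<eta>))) = sec_zero A)"

definition lie_algebroid :: "'a::euclidean_space set \<Rightarrow> ('a, 'e) algebroid \<Rightarrow> bool" where
  "lie_algebroid M A \<longleftrightarrow>
     vector_bundle M A \<and> anchor_morphism A \<and> lie_algebra_on_sections A \<and>
     (\<forall>\<xi>\<in>global_sections A. \<forall>\<eta>\<in>global_sections A. \<forall>x\<in>M.
        anchored A (bracket A \<xi> \<eta>) x = vf_bracket M (anchored A \<xi>) (anchored A \<eta>) x) \<and>
     (\<forall>\<xi>\<in>global_sections A. \<forall>\<eta>\<in>global_sections A. \<forall>f. smooth_on M f \<longrightarrow>
        bracket A \<xi> (sec_mult A f \<eta>) =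
          sec_add A (sec_mult A f (bracket A \<xi> \<eta>))
            (sec_mult A (\<lambda>x. deriv_along M f x (anchored A \<xi> x)) \<eta>))"

definition transitive_lie_algebroid ::
  "'a::euclidean_space set \<Rightarrow> ('a, 'e) algebroid \<Rightarrow> bool" where
  "transitive_lie_algebroid M A \<longleftrightarrow>
     lie_algebroid M A \<and> (\<forall>x\<in>M. anchor A x ` fibre A x = tangent M x)"

text \<open>
  The Lie algebroid restriction to a submanifold \<open>N\<close> is the subbundle \<open>\<rho>\<^sup>-\<^sup>1(TN)\<close> of the vector
  bundle restriction. Its trivializations are all those for which smoothness of a section agrees
  with smoothness as a section of the vector bundle restriction. The bracket of the inverse image
  Lie algebroid along an inclusion is computed at \<open>x\<close> from global sections \<open>\<xi>\<close>, \<open>\<eta>\<close> that extend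
  the given ones from a neighbourhood of \<open>x\<close> in \<open>N\<close>; the value does not depend on their choice.
\<close>

definition restr_fibre :: "('a::euclidean_space, 'e) algebroid \<Rightarrow> 'a set \<Rightarrow> 'a \<Rightarrow> 'e set" where
  "restr_fibre A N x = {v \<in> fibre A x. anchor A x v \<in> tangent N x}"

definition alg_restrict ::
  "('a::euclidean_space, 'e) algebroid \<Rightarrow> 'a set \<Rightarrow> ('a, 'e) algebroid" where
  "alg_restrict A N =
     \<lparr> base = N,
       fibre = restr_fibre A N,
       vzero = vzero A,
       vadd = vadd A,
       vscale = vscale A,
       trivs = {(W, r, \<phi>).
         openin (top_of_set N) W \<and>
         (\<forall>x\<in>W. linear_iso_coords A x (restr_fibre A N x) r (\<phi> x)) \<and>
         (\<forall>V s. openin (top_of_set N) V \<longrightarrow> V \<subseteq> W \<longrightarrow> s \<in> (\<Pi>\<^sub>E x\<in>V. restr_fibre A N x) \<longrightarrow>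
            (s \<in> smooth_sections A V \<longleftrightarrow> (\<forall>i<r. smooth_on V (\<lambda>x. \<phi> x (s x) i))))},
       anchor = anchor A,
       bracket = (\<lambda>\<sigma> \<tau>. \<lambda>x\<in>N. THE v. \<exists>V \<xi> \<eta>.
         openin (top_of_set N) V \<and> x \<in> V \<and>
         \<xi> \<in> global_sections A \<and> \<eta> \<in> global_sections A \<and>
         (\<forall>y\<in>V. \<xi> y = \<sigma> y \<and> \<eta> y = \<tau> y) \<and>
         v = bracket A \<xi> \<eta> x) \<rparr>"

text \<open>
  Equality of Lie algebroids. Equality of records would be too strict: it would distinguish
  different trivialization atlases of the same smooth structure and see irrelevant values outside
  the base.
\<close>

definition same_algebroid ::
  "('a::euclidean_space, 'e) algebroid \<Rightarrow> ('a, 'e) algebroid \<Rightarrow> bool" where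
  "same_algebroid A B \<longleftrightarrow>
     base A = base B \<and>
     (\<forall>x\<in>base A.
        fibre A x = fibre B x \<and>
        vzero A x = vzero B x \<and>
        (\<forall>v\<in>fibre A x. \<forall>w\<in>fibre A x. vadd A x v w = vadd B x v w) \<and>
        (\<forall>c. \<forall>v\<in>fibre A x. vscale A x c v = vscale B x c v) \<and>
        (\<forall>v\<in>fibre A x. anchor A x v = anchor B x v)) \<and>
     (\<forall>V. openin (top_of_set (base A)) V \<longrightarrow> smooth_sections A V = smooth_sections B V) \<and>
     (\<forall>\<xi>\<in>global_sections A. \<forall>\<eta>\<in>global_sections A. bracket A \<xi> \<eta> = bracket B \<xi> \<eta>)"

text \<open>
  \<^const>\<open>simplicial_complex\<close> contains the requirement that the complex is finite. It also admits
  the empty set as a simplex, which does not count as a simplex here.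
\<close>

definition lie_algebroid_complex ::
  "'a::euclidean_space set set \<Rightarrow> ('a set \<Rightarrow> ('a, 'e) algebroid) \<Rightarrow> bool" where
  "lie_algebroid_complex K \<A> \<longleftrightarrow>
     (\<forall>\<Delta>\<in>K - {{}}. transitive_lie_algebroid \<Delta> (\<A> \<Delta>)) \<and>
     (\<forall>\<Delta>\<in>K - {{}}. \<forall>\<Delta>'\<in>K - {{}}. \<Delta>' face_of \<Delta> \<longrightarrow>
        same_algebroid (alg_restrict (\<A> \<Delta>) \<Delta>') (\<A> \<Delta>'))"

text \<open>
  A form of degree \<open>p\<close> assigns to each point \<open>x\<close> of the base an alternating \<open>p\<close>-linear map on the
  fibre, whose arguments are given as a list of length \<open>p\<close>; it is \<open>0\<close> on all other arguments.
  It is smooth if its coefficients with respect to the local frames are smooth.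
\<close>

definition forms ::
  "nat \<Rightarrow> ('a::euclidean_space, 'e, 'm) vbundle_scheme \<Rightarrow> ('a \<Rightarrow> 'e list \<Rightarrow> real) set" where
  "forms p E = {\<omega>.
     (\<forall>x vs. \<not> (x \<in> base E \<and> length vs = p \<and> set vs \<subseteq> fibre E x) \<longrightarrow> \<omega> x vs = 0) \<and>
     (\<forall>x\<in>base E. \<forall>vs. length vs = p \<longrightarrow> set vs \<subseteq> fibre E x \<longrightarrow>
        (\<forall>i<p. \<forall>v\<in>fibre E x. \<forall>w\<in>fibre E x.
           \<omega> x (vs[i := vadd E x v w]) = \<omega> x (vs[i := v]) + \<omega> x (vs[i := w])) \<and>
        (\<forall>i<p. \<forall>v\<in>fibre E x. \<forall>c. \<omega> x (vs[i := vscale E x c v]) = c * \<omega> x (vs[i := v])) \<and>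
        (\<forall>i<p. \<forall>j<p. i \<noteq> j \<longrightarrow> vs ! i = vs ! j \<longrightarrow> \<omega> x vs = 0)) \<and>
     (\<forall>(W, r, \<phi>) \<in> trivs E. \<forall>is. length is = p \<longrightarrow> set is \<subseteq> {..<r} \<longrightarrow>
        smooth_on W (\<lambda>x. \<omega> x (map (\<lambda>i. local_frame E \<phi> i x) is)))}"

definition form_restrict ::
  "('a::euclidean_space, 'e) algebroid \<Rightarrow> 'a set \<Rightarrow> ('a \<Rightarrow> 'e list \<Rightarrow> real) \<Rightarrow> 'a \<Rightarrow> 'e list \<Rightarrow> real"
  where
  "form_restrict A N \<omega> =
     (\<lambda>x vs. if x \<in> N \<and> set vs \<subseteq> fibre (alg_restrict A N) x then \<omega> x vs else 0)"

text \<open>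
  The real vector space of sections over an open set is represented by a module record whose ring
  multiplication and unit (\<^const>\<open>mult\<close>, \<^const>\<open>one\<close>) are irrelevant. The field \<open>opens\<close> is the
  base of open sets (all open sets in case of a sheaf), and \<open>res P U V\<close> is the restriction map
  from \<open>U\<close> to \<open>V \<subseteq> U\<close>.
\<close>

record ('a, 's) presheaf =
  opens :: "'a set set"
  sect :: "'a set \<Rightarrow> (real, 's) module"
  res :: "'a set \<Rightarrow> 'a set \<Rightarrow> 's \<Rightarrow> 's"

definition real_module ::
  "'s set \<Rightarrow> 's \<Rightarrow> ('s \<Rightarrow> 's \<Rightarrow> 's) \<Rightarrow> (real \<Rightarrow> 's \<Rightarrow> 's) \<Rightarrow> (real, 's) module" where
  "real_module C z a m =
     \<lparr> carrier = C, monoid.mult = undefined, one = undefined, zero = z, add = a,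
       module.smult = m \<rparr>"

definition germ :: "('a, 's) presheaf \<Rightarrow> 'a \<Rightarrow> 'a set \<Rightarrow> 's \<Rightarrow> ('a set \<times> 's) set" where
  "germ P x U s =
     {(V, t). V \<in> opens P \<and> x \<in> V \<and> t \<in> carrier (sect P V) \<and>
        (\<exists>W\<in>opens P. x \<in> W \<and> W \<subseteq> U \<inter> V \<and> res P U W s = res P V W t)}"

definition stalk :: "('a, 's) presheaf \<Rightarrow> 'a \<Rightarrow> (real, ('a set \<times> 's) set) module" where
  "stalk P x = real_module
     {germ P x U s | U s. U \<in> opens P \<and> x \<in> U \<and> s \<in> carrier (sect P U)}
     (THE k. \<exists>U\<in>opens P. x \<in> U \<and> k = germ P x U \<zero>\<^bsub>sect P U\<^esub>)
     (\<lambda>g h. THE k. \<exists>U s t. (U, s) \<in> g \<and> (U, t) \<in> h \<and> k = germ P x U (s \<oplus>\<^bsub>sect P U\<^esub> t))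
     (\<lambda>c g. THE k. \<exists>U s. (U, s) \<in> g \<and> k = germ P x U (c \<odot>\<^bsub>sect P U\<^esub> s))"

text \<open>
  The sheaf of germs: a section over \<open>W\<close> is a choice of a germ at each point of \<open>W\<close> that is locally
  induced by sections of the presheaf.
\<close>

definition sheafification ::
  "'a topology \<Rightarrow> ('a, 's) presheaf \<Rightarrow> ('a, 'a \<Rightarrow> ('a set \<times> 's) set) presheaf" where
  "sheafification X P =
     \<lparr> opens = {W. openin X W},
       sect = (\<lambda>W. real_module
         {\<sigma> \<in> (\<Pi>\<^sub>E x\<in>W. carrier (stalk P x)).
            \<forall>x\<in>W. \<exists>U\<in>opens P. x \<in> U \<and> U \<subseteq> W \<and>
              (\<exists>s\<in>carrier (sect P U). \<forall>y\<in>U. \<sigma> y = germ P y U s)}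
         (\<lambda>x\<in>W. \<zero>\<^bsub>stalk P x\<^esub>)
         (\<lambda>\<sigma> \<tau>. \<lambda>x\<in>W. \<sigma> x \<oplus>\<^bsub>stalk P x\<^esub> \<tau> x)
         (\<lambda>c \<sigma>. \<lambda>x\<in>W. c \<odot>\<^bsub>stalk P x\<^esub> \<sigma> x)),
       res = (\<lambda>W V \<sigma>. restrict \<sigma> V) \<rparr>"

definition sheaf_endomorphism :: "('a, 's) presheaf \<Rightarrow> ('a set \<Rightarrow> 's \<Rightarrow> 's) \<Rightarrow> bool" where
  "sheaf_endomorphism S h \<longleftrightarrow>
     (\<forall>W\<in>opens S.
        h W \<in> carrier (sect S W) \<rightarrow> carrier (sect S W) \<and>
        (\<forall>s\<in>carrier (sect S W). \<forall>t\<in>carrier (sect S W).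
           h W (s \<oplus>\<^bsub>sect S W\<^esub> t) = h W s \<oplus>\<^bsub>sect S W\<^esub> h W t) \<and>
        (\<forall>c. \<forall>s\<in>carrier (sect S W). h W (c \<odot>\<^bsub>sect S W\<^esub> s) = c \<odot>\<^bsub>sect S W\<^esub> h W s)) \<and>
     (\<forall>W\<in>opens S. \<forall>V\<in>opens S. V \<subseteq> W \<longrightarrow>
        (\<forall>s\<in>carrier (sect S W). h V (res S W V s) = res S W V (h W s)))"

definition stalk_map ::
  "('a, 's) presheaf \<Rightarrow> ('a set \<Rightarrow> 's \<Rightarrow> 's) \<Rightarrow> 'a \<Rightarrow> ('a set \<times> 's) set \<Rightarrow> ('a set \<times> 's) set" where
  "stalk_map S h x g = (THE k. \<exists>U s. (U, s) \<in> g \<and> k = germ S x U (h U s))"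

definition endo_support ::
  "'a topology \<Rightarrow> ('a, 's) presheaf \<Rightarrow> ('a set \<Rightarrow> 's \<Rightarrow> 's) \<Rightarrow> 'a set" where
  "endo_support X S h =
     X closure_of {x \<in> topspace X. \<exists>g\<in>carrier (stalk S x). stalk_map S h x g \<noteq> \<zero>\<^bsub>stalk S x\<^esub>}"

definition locally_finite_open_cover :: "'a topology \<Rightarrow> 'i set \<Rightarrow> ('i \<Rightarrow> 'a set) \<Rightarrow> bool" where
  "locally_finite_open_cover X J U \<longleftrightarrow>
     (\<forall>j\<in>J. openin X (U j)) \<and> (\<Union>j\<in>J. U j) = topspace X \<and>
     (\<forall>x\<in>topspace X. \<exists>V. openin X V \<and> x \<in> V \<and> finite {j \<in> J. U j \<inter> V \<noteq> {}})"

text \<open>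
  The sum of the possibly infinite, but locally finite, family of endomorphisms is formed
  stalkwise, over the nonzero terms. The first argument fixes the type \<open>'i\<close> from which the index
  sets of the coverings are taken.
\<close>

definition fine_sheaf :: "'i itself \<Rightarrow> 'a topology \<Rightarrow> ('a, 's) presheaf \<Rightarrow> bool" where
  "fine_sheaf (ty :: 'i itself) X S \<longleftrightarrow>
     (\<forall>(J :: 'i set) U. locally_finite_open_cover X J U \<longrightarrow>
        (\<exists>h. (\<forall>j\<in>J. sheaf_endomorphism S (h j) \<and> endo_support X S (h j) \<subseteq> U j) \<and>
             (\<forall>x\<in>topspace X. \<forall>g\<in>carrier (stalk S x).
                (\<Oplus>\<^bsub>stalk S x\<^esub> j\<in>{j\<in>J. stalk_map S (h j) x g \<noteq> \<zero>\<^bsub>stalk S x\<^esub>}.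
                   stalk_map S (h j) x g) = g)))"

abbreviation realization :: "'a::euclidean_space set set \<Rightarrow> 'a topology" where
  "realization K \<equiv> top_of_set (\<Union>K)"

definition carrier_simplex :: "'a::euclidean_space set set \<Rightarrow> 'a \<Rightarrow> 'a set" where
  "carrier_simplex K a = (THE \<Delta>. \<Delta> \<in> K \<and> a \<in> rel_interior \<Delta>)"

definition gen_star :: "'a::euclidean_space set set \<Rightarrow> 'a \<Rightarrow> 'a set" where
  "gen_star K a = \<Union>(rel_interior ` {\<Delta> \<in> K. a \<in> \<Delta>})"

definition regular_open_nbhd :: "'a::euclidean_space set set \<Rightarrow> 'a \<Rightarrow> 'a set \<Rightarrow> bool" where
  "regular_open_nbhd K a U \<longleftrightarrow>
     a \<in> \<Union>K \<and> (\<exists>Z. openin (realization K) Z \<and> a \<in> Z \<and> U = Z \<inter> gen_star K a)"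

text \<open>
  The index set of the family \<open>K\<^sup>U\<close>: since \<open>\<Delta> \<mapsto> \<Delta>\<^sub>U = U \<inter> \<Delta>\<close> is injective on it, families
  indexed by the \<open>\<Delta>\<^sub>U\<close> are represented as families indexed by the \<open>\<Delta>\<close>. The condition does not
  depend on the choice of \<open>a\<close>.
\<close>

definition local_simplices :: "'a::euclidean_space set set \<Rightarrow> 'a set \<Rightarrow> 'a set set" where
  "local_simplices K U =
     {\<Delta> \<in> K. \<exists>a. regular_open_nbhd K a U \<and> carrier_simplex K a face_of \<Delta>}"

definition derived_complex ::
  "('a::euclidean_space set \<Rightarrow> ('a, 'e) algebroid) \<Rightarrow> 'a set \<Rightarrow> 'a set \<Rightarrow> ('a, 'e) algebroid" where
  "derived_complex \<A> U \<Delta> = alg_restrict (\<A> \<Delta>) (U \<inter> \<Delta>)"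

definition ps_forms ::
  "'a::euclidean_space set set \<Rightarrow> ('a set \<Rightarrow> ('a, 'e) algebroid) \<Rightarrow> nat \<Rightarrow> 'a set
     \<Rightarrow> ('a set \<Rightarrow> 'a \<Rightarrow> 'e list \<Rightarrow> real) set" where
  "ps_forms K \<A> p U = {\<omega>.
     (\<forall>\<Delta>\<in>local_simplices K U. \<omega> \<Delta> \<in> forms p (derived_complex \<A> U \<Delta>)) \<and>
     (\<forall>\<Delta>. \<Delta> \<notin> local_simplices K U \<longrightarrow> \<omega> \<Delta> = (\<lambda>x vs. 0)) \<and>
     (\<forall>\<Delta>\<in>local_simplices K U. \<forall>\<Delta>'\<in>local_simplices K U.
        form_restrict (derived_complex \<A> U \<Delta>) ((U \<inter> \<Delta>) \<inter> (U \<inter> \<Delta>')) (\<omega> \<Delta>) =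
        form_restrict (derived_complex \<A> U \<Delta>') ((U \<inter> \<Delta>) \<inter> (U \<inter> \<Delta>')) (\<omega> \<Delta>'))}"

definition ps_form_restrict ::
  "'a::euclidean_space set set \<Rightarrow> ('a set \<Rightarrow> ('a, 'e) algebroid) \<Rightarrow> 'a set \<Rightarrow> 'a set
     \<Rightarrow> ('a set \<Rightarrow> 'a \<Rightarrow> 'e list \<Rightarrow> real) \<Rightarrow> ('a set \<Rightarrow> 'a \<Rightarrow> 'e list \<Rightarrow> real)" where
  "ps_form_restrict K \<A> U V \<omega> =
     (\<lambda>\<Delta>. if \<Delta> \<in> local_simplices K V
           then form_restrict (derived_complex \<A> U \<Delta>) (V \<inter> \<Delta>) (\<omega> \<Delta>)
           else (\<lambda>x vs. 0))"

definition ps_presheaf ::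
  "'a::euclidean_space set set \<Rightarrow> ('a set \<Rightarrow> ('a, 'e) algebroid) \<Rightarrow> nat
     \<Rightarrow> ('a, 'a set \<Rightarrow> 'a \<Rightarrow> 'e list \<Rightarrow> real) presheaf" where
  "ps_presheaf K \<A> p =
     \<lparr> opens = {U. \<exists>a. regular_open_nbhd K a U},
       sect = (\<lambda>U. real_module (ps_forms K \<A> p U)
         (\<lambda>\<Delta> x vs. 0)
         (\<lambda>\<omega> \<eta> \<Delta> x vs. \<omega> \<Delta> x vs + \<eta> \<Delta> x vs)
         (\<lambda>c \<omega> \<Delta> x vs. c * \<omega> \<Delta> x vs)),
       res = ps_form_restrict K \<A> \<rparr>"

definition ps_sheaf where
  "ps_sheaf K \<A> p = sheafification (realization K) (ps_presheaf K \<A> p)"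

end

theory Submission
  imports Defs
begin

text \<open>
  The realization of a finite complex is a compact subset of a Euclidean space, so a locally finite
  open covering has only finitely many nonempty members and admits a subordinate partition of unity
  \<open>f\<^sub>j\<close> by functions that are smooth on the ambient space. Multiplication by \<open>f\<^sub>j\<close> is an endomorphism
  of the presheaf of piecewise smooth forms. An endomorphism of a presheaf acts on germs, hence on
  the sheaf of germs, and vanishing off a closed set as well as summing up to the identity are
  inherited first by the stalks of the presheaf and then, by the same argument applied to the
  sheaf of germs, by the stalks of the latter.
\<close>

section \<open>Smooth partitions of unity\<close>

text \<open>The obstacle is that forms over different \<open>U\<close> live on different algebroids,
  the restrictions to \<open>U \<inter> \<Delta>\<close>. Simplices are convex, so an open piece of
  a simplex has the same tangent spaces and hence the same fibres; restriction to a smaller regular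
  open set becomes a plain cut-off, with which multiplication by a function commutes. One function
  on the ambient space multiplies the components on all simplices at once and so preserves their
  agreement on common faces. The sheaf-theoretic half knows nothing of forms: it asks for presheaf
  endomorphisms that kill every section over a set missing a closed \<open>C j\<close> inside
  \<open>U j\<close>. Phrased through \<open>C j\<close>, the support condition can be handed on
  from level to level. Since \<open>fine_sheaf\<close> speaks of the stalks of the sheaf of germs,
  whose elements are germs of families of germs, one locale is instantiated at both levels instead
  of identifying the two kinds of stalk.\<close>

lemma Ck_on_cong_imp:
  assumes "open S" "Ck_on k S f" "\<And>x. x \<in> S \<Longrightarrow> f x = g x"
  shows "Ck_on k S g"
  using assms(2,3)
proof (induction k arbitrary: f g)
  case 0
  then show ?case
    using continuous_on_cong[of S S f g] by simp
next
  case (Suc k)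
  \<comment> \<open>Derivatives are taken in the ambient space, so agreement on an open set
    determines them there.\<close>
  have D: "frechet_derivative f (at x) = frechet_derivative g (at x)" if "x \<in> S" for x
    using frechet_derivative_transform_within_open[OF _ assms(1) that, of f g] Suc.prems that by auto
  have "g differentiable (at x)" if "x \<in> S" for x
  proof -
    have "f differentiable (at x)"
      using Suc.prems(1) that by simp
    then show ?thesis
      using that assms(1) Suc.prems(2) has_derivative_transform_within_open[of f _ x UNIV S g]
      unfolding differentiable_def by auto
  qed
  moreover have "Ck_on k S (\<lambda>x. frechet_derivative g (at x) v)" for v
  proof (rule Suc.IH)
    show "Ck_on k S (\<lambda>x. frechet_derivative f (at x) v)"
      using Suc.prems(1) by simp
  qed (simp add: D)
  ultimately show ?case
    by simp
qed

text \<open>Replaces the chosen \<open>frechet_derivative\<close> by any explicit derivative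
  \<open>f'\<close>, so that the closure properties below reduce to the usual differentiation
  rules.\<close>

lemma Ck_on_SucI:
  assumes "open S" "\<And>x. x \<in> S \<Longrightarrow> (f has_derivative f' x) (at x)"
    and "\<And>v. Ck_on k S (\<lambda>x. f' x v)"
  shows "Ck_on (Suc k) S f"
proof -
  have "Ck_on k S (\<lambda>x. frechet_derivative f (at x) v)" for v
    by (rule Ck_on_cong_imp[OF assms(1) assms(3)[of v]]) (simp flip: frechet_derivative_at[OF assms(2)])
  with assms(2) show ?thesis
    by (auto simp: differentiable_def)
qed

lemma Ck_on_SucD:
  assumes "Ck_on (Suc k) S f"
  shows "\<And>x. x \<in> S \<Longrightarrow> (f has_derivative frechet_derivative f (at x)) (at x)"
    and "\<And>v. Ck_on k S (\<lambda>x. frechet_derivative f (at x) v)"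
  using assms by (auto simp: frechet_derivative_works)

text \<open>Needed wherever a derivative contains the original function again, as in the product
  rule: that factor has to be lowered to the order of the derivative.\<close>

lemma Ck_on_Suc_imp: "Ck_on (Suc k) S f \<Longrightarrow> Ck_on k S f"
proof (induction k arbitrary: f)
  case 0
  then have "continuous (at x) f" if "x \<in> S" for x
    using that by (simp add: differentiable_imp_continuous_within)
  then show ?case
    by (simp add: continuous_at_imp_continuous_on)
next
  case (Suc k)
  from Suc.prems have "Ck_on (Suc k) S (\<lambda>x. frechet_derivative f (at x) v)" for v
    unfolding Ck_on.simps(2)[of "Suc k"] by blast
  then have "Ck_on k S (\<lambda>x. frechet_derivative f (at x) v)" for v
    by (rule Suc.IH)
  with Suc.prems show ?case
    unfolding Ck_on.simps(2) by blast
qed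

lemma Ck_on_subset: "Ck_on k S f \<Longrightarrow> T \<subseteq> S \<Longrightarrow> Ck_on k T f"
  by (induction k arbitrary: f) (auto intro: continuous_on_subset)

lemma Ck_on_const: "open S \<Longrightarrow> Ck_on k S (\<lambda>x. c)"
proof (induction k arbitrary: c)
  case (Suc k)
  show ?case
    by (rule Ck_on_SucI[where f' = "\<lambda>_ _. 0"]) (use Suc in auto)
qed simp

lemma Ck_on_add:
  assumes "open S"
  shows "Ck_on k S f \<Longrightarrow> Ck_on k S g \<Longrightarrow> Ck_on k S (\<lambda>x. f x + g x)"
proof (induction k arbitrary: f g)
  case (Suc k)
  note f = Ck_on_SucD[OF Suc.prems(1)] and g = Ck_on_SucD[OF Suc.prems(2)]
  show ?case
    by (rule Ck_on_SucI[OF assms has_derivative_add[OF f(1) g(1)] Suc.IH[OF f(2) g(2)]])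
qed (simp add: continuous_on_add)

lemma Ck_on_mult:
  fixes f g :: "'a::euclidean_space \<Rightarrow> real"
  assumes "open S"
  shows "Ck_on k S f \<Longrightarrow> Ck_on k S g \<Longrightarrow> Ck_on k S (\<lambda>x. f x * g x)"
proof (induction k arbitrary: f g)
  case (Suc k)
  note f = Ck_on_SucD[OF Suc.prems(1)] and g = Ck_on_SucD[OF Suc.prems(2)]
  have D: "Ck_on k S (\<lambda>x. f x * frechet_derivative g (at x) v + frechet_derivative f (at x) v * g x)" for v
    using Ck_on_Suc_imp[OF Suc.prems(1)] Ck_on_Suc_imp[OF Suc.prems(2)]
    by (intro Ck_on_add[OF assms] Suc.IH f(2) g(2))
  show ?case
    by (rule Ck_on_SucI[OF assms has_derivative_mult[OF f(1) g(1)] D])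
qed (simp add: continuous_on_mult)

lemma Ck_on_sum:
  assumes "open S" "\<And>i. i \<in> I \<Longrightarrow> Ck_on k S (f i)"
  shows "Ck_on k S (\<lambda>x. \<Sum>i\<in>I. f i x)"
  using assms(2)
  by (induction I rule: infinite_finite_induct) (auto intro: Ck_on_add Ck_on_const assms(1))

text \<open>Differentiating \<open>1 / f\<close> returns \<open>1 / f\<close> as a factor, for which
  the induction hypothesis at the lower order is available; \<open>f\<close> stays fixed
  throughout.\<close>

lemma Ck_on_inverse:
  fixes f :: "'a::euclidean_space \<Rightarrow> real"
  assumes "open S" "\<And>x. x \<in> S \<Longrightarrow> f x \<noteq> 0"
  shows "Ck_on k S f \<Longrightarrow> Ck_on k S (\<lambda>x. inverse (f x))"
proof (induction k)
  case 0
  then show ?case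
    using assms(2) by (simp add: continuous_on_inverse)
next
  case (Suc k)
  note f = Ck_on_SucD[OF Suc.prems]
  have "Ck_on k S (\<lambda>x. (- 1) * (inverse (f x) * frechet_derivative f (at x) v * inverse (f x)))" for v
    by (intro Ck_on_mult Ck_on_const assms(1) f(2) Suc.IH Ck_on_Suc_imp[OF Suc.prems])
  then show ?case
    by (intro Ck_on_SucI[OF assms(1) Deriv.has_derivative_inverse[OF assms(2) f(1)]]) auto
qed

lemma Ck_on_inner:
  assumes "open S"
  shows "Ck_on k S (\<lambda>x::'a::euclidean_space. x \<bullet> w)"
proof (cases k)
  case (Suc k')
  have "(( \<lambda>x. x \<bullet> w) has_derivative (\<lambda>v. v \<bullet> w)) (at x)" for x
    by (auto intro!: derivative_eq_intros)
  then show ?thesis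
    unfolding Suc by (rule Ck_on_SucI[OF assms _ Ck_on_const[OF assms]])
qed (simp add: continuous_on_inner)

section \<open>A flat function and smooth bump functions\<close>

text \<open>Derivatives of members of this family are linear combinations of members.\<close>

definition flat_exp :: "nat \<Rightarrow> real \<Rightarrow> real" where
  "flat_exp n t = (if t > 0 then inverse t ^ n * exp (- inverse t) else 0)"

text \<open>On the right, substituting \<open>s = inverse t\<close> turns this into the decay of
  \<open>s ^ n / exp s\<close> at infinity; on the left the function is constantly 0.\<close>

lemma flat_exp_tendsto_0: "(flat_exp n \<longlongrightarrow> 0) (at 0)"
proof (rule filterlim_split_at_real)
  show "(flat_exp n \<longlongrightarrow> 0) (at_left 0)"
    by (rule tendsto_eventually) (auto simp: eventually_at_filter flat_exp_def)
  have "((\<lambda>t. inverse t ^ n / exp (inverse t)) \<longlongrightarrow> 0) (at_right (0::real))"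
    using filterlim_compose[OF tendsto_power_div_exp_0 filterlim_inverse_at_top_right] by simp
  then show "(flat_exp n \<longlongrightarrow> 0) (at_right 0)"
    by (rule Lim_transform_eventually)
      (auto simp: eventually_at_filter flat_exp_def exp_minus divide_inverse)
qed

lemma DERIV_flat_exp:
  "(flat_exp n has_real_derivative flat_exp (n + 2) t - real n * flat_exp (n + 1) t) (at t)"
proof (cases t "0::real" rule: linorder_cases)
  case less
  have "(flat_exp n has_real_derivative 0) (at t)"
    by (rule has_field_derivative_transform_within_open[OF DERIV_const[of 0], where S = "{..<0}"])
      (use less in \<open>auto simp: flat_exp_def\<close>)
  with less show ?thesis
    by (simp add: flat_exp_def)
next
  case equal
  \<comment> \<open>The difference quotient of \<open>flat_exp n\<close> at 0 is
    \<open>flat_exp (n + 1)\<close>, one reason for carrying the power \<open>n\<close>.\<close>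
  have "((\<lambda>h. (flat_exp n (0 + h) - flat_exp n 0) / h) \<longlongrightarrow> 0) (at 0)"
    by (rule Lim_transform_eventually[OF flat_exp_tendsto_0[of "n + 1"]])
      (auto simp: eventually_at_filter flat_exp_def divide_inverse)
  with equal show ?thesis
    by (simp add: flat_exp_def DERIV_def)
next
  case greater
  have "((\<lambda>t. inverse t ^ n) has_real_derivative - (real n * inverse t ^ (n + 1))) (at t)"
    using DERIV_power[OF DERIV_inverse[of t UNIV], of n] greater by (cases n) (simp_all add: ac_simps)
  moreover have "((\<lambda>t. exp (- inverse t)) has_real_derivative inverse t ^ 2 * exp (- inverse t)) (at t)"
    using greater by (auto intro!: derivative_eq_intros simp: power2_eq_square)
  ultimately have "((\<lambda>t. inverse t ^ n * exp (- inverse t)) has_real_derivative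
      - (real n * inverse t ^ (n + 1)) * exp (- inverse t)
        + inverse t ^ 2 * exp (- inverse t) * inverse t ^ n) (at t)"
    by (rule DERIV_mult)
  then have "((\<lambda>t. inverse t ^ n * exp (- inverse t)) has_real_derivative
      flat_exp (n + 2) t - real n * flat_exp (n + 1) t) (at t)"
    using greater by (simp add: flat_exp_def algebra_simps power2_eq_square)
  then show ?thesis
    by (rule has_field_derivative_transform_within_open[where S = "{0<..}"])
      (use greater in \<open>auto simp: flat_exp_def\<close>)
qed

text \<open>\<open>n\<close> is generalised in the induction because differentiation moves to the
  indices \<open>n + 1\<close> and \<open>n + 2\<close>.\<close>

lemma Ck_on_flat_exp:
  assumes "open S"
  shows "Ck_on k S f \<Longrightarrow> Ck_on k S (\<lambda>x. flat_exp n (f x))"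
proof (induction k arbitrary: n)
  case 0
  have "continuous_on UNIV (flat_exp n)"
    using DERIV_isCont[OF DERIV_flat_exp] by (simp add: continuous_at_imp_continuous_on)
  from continuous_on_compose2[OF this, of S f] 0 show ?case
    by simp
next
  case (Suc k)
  note f = Ck_on_SucD[OF Suc.prems]
  have D: "((\<lambda>x. flat_exp n (f x)) has_derivative (\<lambda>v. frechet_derivative f (at x) v *
      (flat_exp (n + 2) (f x) + (- real n) * flat_exp (n + 1) (f x)))) (at x)" if "x \<in> S" for x
    using has_derivative_compose[OF f(1)[OF that], of "flat_exp n"
        "(*) (flat_exp (n + 2) (f x) - real n * flat_exp (n + 1) (f x))"]
      DERIV_flat_exp[of n "f x"]
    by (simp add: has_field_derivative_def mult.commute)
  show ?case
    by (intro Ck_on_SucI[OF assms D] Ck_on_mult Ck_on_add Ck_on_const assms f(2) Suc.IH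
        Ck_on_Suc_imp[OF Suc.prems])
qed

lemma bump_function_exists:
  fixes c :: "'a::euclidean_space" and r :: real
  obtains b :: "'a \<Rightarrow> real" where "\<And>k. Ck_on k UNIV b"
    and "\<And>x. x \<in> ball c r \<Longrightarrow> b x > 0" and "\<And>x. x \<notin> ball c r \<Longrightarrow> b x = 0"
proof (cases "r > 0")
  case True
  define u where "u x = r\<^sup>2 + (- 1) * ((x - c) \<bullet> (x - c))" for x :: 'a
  have "(u has_derivative (\<lambda>v. (- 2) * (x \<bullet> v + (- (c \<bullet> v))))) (at x)" for x
    unfolding u_def
    by (auto intro!: derivative_eq_intros simp: inner_diff_left inner_commute algebra_simps)
  \<comment> \<open>The quadratic \<open>u\<close> is not of the form treated by
    \<open>Ck_on_inner\<close>, but its derivative in a fixed direction is affine; order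
    \<open>Suc k\<close> is proved from that and then lowered.\<close>
  then have "Ck_on (Suc k) UNIV u" for k
    by (rule Ck_on_SucI[OF open_UNIV]) (intro Ck_on_mult Ck_on_add Ck_on_const Ck_on_inner open_UNIV)
  then have Ck: "Ck_on k UNIV (\<lambda>x. flat_exp 0 (u x))" for k
    by (rule Ck_on_flat_exp[OF open_UNIV Ck_on_Suc_imp])
  have u_pos: "u x > 0 \<longleftrightarrow> x \<in> ball c r" for x
  proof -
    have "u x > 0 \<longleftrightarrow> (norm (x - c))\<^sup>2 < r\<^sup>2"
      by (simp add: u_def power2_norm_eq_inner)
    also have "\<dots> \<longleftrightarrow> norm (x - c) < r"
      using True power_less_imp_less_base[of "norm (x - c)" 2 r] power_strict_mono[of "norm (x - c)" r 2]
      by auto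
    finally show ?thesis
      by (simp add: dist_norm norm_minus_commute)
  qed
  have pos: "flat_exp 0 (u x) > 0" if "x \<in> ball c r" for x
    using that u_pos[of x] by (simp add: flat_exp_def)
  have zero: "flat_exp 0 (u x) = 0" if "x \<notin> ball c r" for x
    using that u_pos[of x] by (simp add: flat_exp_def)
  show ?thesis
    using Ck pos zero by (rule that)
next
  case False
  have "x \<notin> ball c r" for x
    using False zero_le_dist[of c x] by (simp add: not_less del: zero_le_dist)
  then show ?thesis
    by (intro that[of "\<lambda>_. 0"] Ck_on_const[OF open_UNIV]) auto
qed

section \<open>Smooth functions on arbitrary subsets\<close>

lemma smooth_onI_Ck:
  assumes "open G" "M \<subseteq> G" "\<And>k. Ck_on k G f"
  shows "smooth_on M f"
  using assms unfolding smooth_on_def by blast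

lemma smooth_on_subset:
  assumes "smooth_on M f" "N \<subseteq> M"
  shows "smooth_on N f"
  unfolding smooth_on_def
proof
  fix x assume "x \<in> N"
  with assms(2) have "x \<in> M"
    by (rule subsetD)
  from bspec[OF assms(1)[unfolded smooth_on_def] this]
  show "\<exists>G g. open G \<and> x \<in> G \<and> (\<forall>k. Ck_on k G g) \<and> (\<forall>y\<in>G \<inter> N. g y = f y)"
    by (elim ex_forward conj_forward all_forward) (use assms(2) in auto)
qed

lemma smooth_on_cong: "(\<And>x. x \<in> M \<Longrightarrow> f x = g x) \<Longrightarrow> smooth_on M f \<longleftrightarrow> smooth_on M g"
  unfolding smooth_on_def by simp

lemma smooth_on_const: "smooth_on M (\<lambda>x. c)"
  by (rule smooth_onI_Ck[of UNIV]) (auto intro: Ck_on_const)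

text \<open>Local ambient extensions of \<open>f\<close> and \<open>g\<close> live on different
  neighbourhoods of a point, and their intersection carries the combination. The premise
  \<open>op\<close> speaks of all open sets because these neighbourhoods are not known
  beforehand.\<close>

lemma smooth_on_combine:
  fixes M :: "'a::euclidean_space set"
  assumes f: "smooth_on M f" and g: "smooth_on M g"
    and op: "\<And>(G :: 'a set) k f g. open G \<Longrightarrow> Ck_on k G f \<Longrightarrow> Ck_on k G g \<Longrightarrow> Ck_on k G (\<lambda>x. F (f x) (g x))"
  shows "smooth_on M (\<lambda>x. F (f x) (g x))"
  unfolding smooth_on_def
proof
  fix x assume x: "x \<in> M"
  obtain G f' where G: "open G" "x \<in> G" "\<forall>k. Ck_on k G f'" "\<forall>y\<in>G \<inter> M. f' y = f y"
    using bspec[OF f[unfolded smooth_on_def] x] by (elim exE conjE)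
  obtain H g' where H: "open H" "x \<in> H" "\<forall>k. Ck_on k H g'" "\<forall>y\<in>H \<inter> M. g' y = g y"
    using bspec[OF g[unfolded smooth_on_def] x] by (elim exE conjE)
  have Ck: "Ck_on k (G \<inter> H) (\<lambda>x. F (f' x) (g' x))" for k
    by (rule op[OF open_Int[OF G(1) H(1)] Ck_on_subset[OF G(3)[rule_format]]
          Ck_on_subset[OF H(3)[rule_format]]]) auto
  have eq: "\<forall>y\<in>G \<inter> H \<inter> M. F (f' y) (g' y) = F (f y) (g y)"
    using G(4) H(4) by simp
  show "\<exists>G h. open G \<and> x \<in> G \<and> (\<forall>k. Ck_on k G h) \<and> (\<forall>y\<in>G \<inter> M. h y = F (f y) (g y))"
    by (rule exI[of _ "G \<inter> H"], rule exI[of _ "\<lambda>x. F (f' x) (g' x)"])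
      (intro conjI allI open_Int IntI G(1,2) H(1,2) Ck eq)
qed

lemma smooth_on_add: "smooth_on M f \<Longrightarrow> smooth_on M g \<Longrightarrow> smooth_on M (\<lambda>x. f x + g x)"
  by (rule smooth_on_combine) (auto intro: Ck_on_add)

lemma smooth_on_mult:
  fixes f g :: "'a::euclidean_space \<Rightarrow> real"
  shows "smooth_on M f \<Longrightarrow> smooth_on M g \<Longrightarrow> smooth_on M (\<lambda>x. f x * g x)"
  by (rule smooth_on_combine) (auto intro: Ck_on_mult)

section \<open>Partitions of unity on compact sets\<close>

lemma locally_finite_cover_of_compact:
  assumes "locally_finite_open_cover X J U" "compact_space X"
  shows "finite {j \<in> J. U j \<noteq> {}}"
proof -
  have "\<forall>x\<in>topspace X. \<exists>V. openin X V \<and> x \<in> V \<and> finite {j \<in> J. U j \<inter> V \<noteq> {}}"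
    using assms(1) by (simp add: locally_finite_open_cover_def)
  from bchoice[OF this] obtain V
    where V: "\<forall>x\<in>topspace X. openin X (V x) \<and> x \<in> V x \<and> finite {j \<in> J. U j \<inter> V x \<noteq> {}}"
    by (elim exE)
  have "(\<forall>S\<in>V ` topspace X. openin X S) \<and> topspace X \<subseteq> \<Union>(V ` topspace X)"
    using V by auto
  with assms(2) obtain T where T: "finite T" "T \<subseteq> V ` topspace X" "topspace X \<subseteq> \<Union>T"
    unfolding compact_space_alt by meson
  \<comment> \<open>Each nonempty \<open>U j\<close> meets one of the finitely many sets in
    \<open>T\<close>, and each of those meets finitely many members. Infinitely many indices may
    carry the empty set, so these have to be left out.\<close>
  have "{j \<in> J. U j \<noteq> {}} \<subseteq> (\<Union>S\<in>T. {j \<in> J. U j \<inter> S \<noteq> {}})"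
  proof
    fix j assume j: "j \<in> {j \<in> J. U j \<noteq> {}}"
    then obtain x where "x \<in> U j" "x \<in> topspace X"
      using assms(1) openin_subset unfolding locally_finite_open_cover_def by blast
    with T(3) j show "j \<in> (\<Union>S\<in>T. {j \<in> J. U j \<inter> S \<noteq> {}})"
      by blast
  qed
  moreover have "finite (\<Union>S\<in>T. {j \<in> J. U j \<inter> S \<noteq> {}})"
    using T V by auto
  ultimately show ?thesis
    by (rule finite_subset)
qed

text \<open>Around each point a ball is chosen whose closed version lies in one member, relative to
  \<open>M\<close>; bumps on finitely many such balls are collected by the chosen index
  \<open>ji\<close> and divided by their total. The closed sets \<open>C j\<close> are handed out
  with the functions because the sheaf argument measures supports by them.\<close>

lemma smooth_partition_of_unity:
  fixes U :: "'i \<Rightarrow> 'a::euclidean_space set"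
  assumes "compact M" "finite J" "\<And>j. j \<in> J \<Longrightarrow> openin (top_of_set M) (U j)" "M \<subseteq> (\<Union>j\<in>J. U j)"
  obtains f :: "'i \<Rightarrow> 'a \<Rightarrow> real" and C :: "'i \<Rightarrow> 'a set"
  where "\<And>j. smooth_on M (f j)" "\<And>j. closedin (top_of_set M) (C j)" "\<And>j. C j \<subseteq> U j"
    and "\<And>j x. x \<in> M \<Longrightarrow> x \<notin> C j \<Longrightarrow> f j x = 0" "\<And>x. x \<in> M \<Longrightarrow> (\<Sum>j\<in>J. f j x) = 1"
proof -
  have "\<forall>x\<in>M. \<exists>j r. j \<in> J \<and> r > 0 \<and> cball x r \<inter> M \<subseteq> U j"
  proof
    fix x assume "x \<in> M"
    then obtain j where j: "j \<in> J" "x \<in> U j"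
      using assms(4) by blast
    then obtain r where "r > 0" "cball x r \<inter> M \<subseteq> U j"
      using assms(3) openin_contains_cball by meson
    with j show "\<exists>j r. j \<in> J \<and> r > 0 \<and> cball x r \<inter> M \<subseteq> U j"
      by blast
  qed
  then obtain ji r where r: "\<And>x. x \<in> M \<Longrightarrow> ji x \<in> J" "\<And>x. x \<in> M \<Longrightarrow> r x > 0"
    "\<And>x. x \<in> M \<Longrightarrow> cball x (r x) \<inter> M \<subseteq> U (ji x)"
    by metis
  have "M \<subseteq> (\<Union>x\<in>M. ball x (r x))"
    using r(2) centre_in_ball by blast
  then obtain T where T: "T \<subseteq> M" "finite T" "M \<subseteq> (\<Union>x\<in>T. ball x (r x))"
    using compactE_image[OF assms(1), of M "\<lambda>x. ball x (r x)"] by auto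
  \<comment> \<open>Stated for all \<open>c\<close>, also those outside \<open>M\<close> where
    \<open>r c\<close> is unspecified, so that the choice of \<open>b\<close> carries no membership
    condition.\<close>
  have "\<exists>b :: 'a \<Rightarrow> real. (\<forall>k. Ck_on k UNIV b) \<and>
      (\<forall>x. if x \<in> ball c (r c) then b x > 0 else b x = 0)" for c
  proof -
    obtain f :: "'a \<Rightarrow> real" where "\<And>k. Ck_on k UNIV f" "\<And>x. x \<in> ball c (r c) \<Longrightarrow> f x > 0"
      "\<And>x. x \<notin> ball c (r c) \<Longrightarrow> f x = 0"
      by (rule bump_function_exists[of c "r c"]) (rule that)
    then show ?thesis
      by (intro exI[of _ f]) auto
  qed
  then obtain b :: "'a \<Rightarrow> 'a \<Rightarrow> real" where b: "\<And>c k. Ck_on k UNIV (b c)"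
    "\<And>c x. if x \<in> ball c (r c) then b c x > 0 else b c x = 0"
    using choice[of "\<lambda>c b. (\<forall>k. Ck_on k UNIV b) \<and>
      (\<forall>x. if x \<in> ball c (r c) then b x > (0::real) else b x = 0)"] by blast
  have b_pos: "b c x > 0" if "x \<in> ball c (r c)" for c x
    using b(2)[where c = c and x = x] that by simp
  have b_0: "b c x = 0" if "x \<notin> ball c (r c)" for c x
    using b(2)[where c = c and x = x] that by simp
  define B where "B x = (\<Sum>c\<in>T. b c x)" for x
  define G where "G = (\<Union>c\<in>T. ball c (r c))"
  have "open G"
    by (auto simp: G_def)
  have B_pos: "B x > 0" if "x \<in> G" for x
  proof -
    from that obtain c where "c \<in> T" "x \<in> ball c (r c)"
      by (auto simp: G_def)
    moreover have "b c x \<ge> 0" for c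
      using b_pos b_0 by (metis less_eq_real_def)
    ultimately show ?thesis
      unfolding B_def using T(2) b_pos by (intro sum_pos2) auto
  qed
  \<comment> \<open>An index chosen by no centre in \<open>T\<close>, in particular one outside
    \<open>J\<close>, gets \<open>f j = 0\<close> and \<open>C j = {}\<close>; this lets the
    properties of a single \<open>f j\<close> and \<open>C j\<close> be claimed for all
    \<open>j\<close>.\<close>
  define f where "f j x = (\<Sum>c | c \<in> T \<and> ji c = j. b c x) * inverse (B x)" for j x
  define C where "C j = (\<Union>c\<in>{c \<in> T. ji c = j}. cball c (r c)) \<inter> M" for j
  have Ck_b: "Ck_on k G (b c)" for k c
    using Ck_on_subset[OF b(1)] by auto
  have Ck_B: "Ck_on k G B" for k
    unfolding B_def[abs_def] by (intro Ck_on_sum Ck_b \<open>open G\<close>)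
  have B_nz: "B x \<noteq> 0" if "x \<in> G" for x
    using B_pos[OF that] by simp
  have Ck_f: "Ck_on k G (f j)" for k j
    unfolding f_def[abs_def]
    by (rule Ck_on_mult[OF \<open>open G\<close> Ck_on_sum[OF \<open>open G\<close> Ck_b]
          Ck_on_inverse[OF \<open>open G\<close> B_nz Ck_B]])
  have "M \<subseteq> G"
    using T(3) by (simp add: G_def)
  have 1: "smooth_on M (f j)" for j
    using \<open>open G\<close> \<open>M \<subseteq> G\<close> Ck_f by (rule smooth_onI_Ck)
  have "closed (\<Union>c\<in>{c \<in> T. ji c = j}. cball c (r c))" for j
    using T(2) by auto
  then have 2: "closedin (top_of_set M) (C j)" for j
    unfolding C_def by (metis closedin_closed_Int inf_commute)
  have 3: "C j \<subseteq> U j" for j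
    using r(3) T(1) by (auto simp: C_def)
  have 4: "f j x = 0" if "x \<in> M" "x \<notin> C j" for j x
  proof -
    have "b c x = 0" if "c \<in> T" "ji c = j" for c
      using that \<open>x \<in> M\<close> \<open>x \<notin> C j\<close> by (intro b_0) (auto simp: C_def)
    then show ?thesis
      by (simp add: f_def)
  qed
  have 5: "(\<Sum>j\<in>J. f j x) = 1" if "x \<in> M" for x
  proof -
    have "(\<Sum>j\<in>J. f j x) = (\<Sum>j\<in>J. \<Sum>c | c \<in> T \<and> ji c = j. b c x) * inverse (B x)"
      by (simp add: f_def sum_distrib_right)
    \<comment> \<open>Every centre in \<open>T\<close> has exactly one index, and it lies in
      \<open>J\<close>; summing over the fibres of \<open>ji\<close> recovers the full sum.\<close>
    also have "(\<Sum>j\<in>J. \<Sum>c | c \<in> T \<and> ji c = j. b c x) = B x"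
      unfolding B_def using T assms(2) r(1) by (intro sum.group) auto
    finally show ?thesis
      using B_nz[of x] \<open>M \<subseteq> G\<close> that by auto
  qed
  show ?thesis
    using that[of f C] 1 2 3 4 5 by blast
qed

section \<open>Endomorphisms of presheaves and of their sheaves of germs\<close>

lemma real_module_simps [simp]:
  "carrier (real_module C z a m) = C"
  "zero (real_module C z a m) = z"
  "add (real_module C z a m) = a"
  "module.smult (real_module C z a m) = m"
  by (simp_all add: real_module_def)

lemma finsum_closed_if:
  assumes "abelian_monoid G" "\<And>i. i \<in> I \<Longrightarrow> f i \<in> carrier G"
  shows "finsum G f I \<in> carrier G"
  using assms by (intro abelian_monoid.finsum_closed) auto

text \<open>Serves two homomorphisms: passing to the germ at a point, and evaluating a section of
  the sheaf of germs at a point.\<close>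

lemma finsum_hom:
  assumes "abelian_monoid G" "abelian_monoid H"
    and "\<phi> \<in> carrier G \<rightarrow> carrier H" "\<phi> \<zero>\<^bsub>G\<^esub> = \<zero>\<^bsub>H\<^esub>"
    and "\<And>s t. s \<in> carrier G \<Longrightarrow> t \<in> carrier G \<Longrightarrow> \<phi> (s \<oplus>\<^bsub>G\<^esub> t) = \<phi> s \<oplus>\<^bsub>H\<^esub> \<phi> t"
    and "finite I" "\<And>i. i \<in> I \<Longrightarrow> f i \<in> carrier G"
  shows "\<phi> (finsum G f I) = finsum H (\<lambda>i. \<phi> (f i)) I"
proof -
  interpret G: abelian_monoid G by fact
  interpret H: abelian_monoid H by fact
  show ?thesis
    using assms(6,7)
  proof (induction I rule: finite_induct)
    case (insert i I)
    then have fi: "f \<in> I \<rightarrow> carrier G" "f i \<in> carrier G"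
      by auto
    have "(\<lambda>i. \<phi> (f i)) \<in> I \<rightarrow> carrier H" "\<phi> (f i) \<in> carrier H"
      using insert.prems assms(3) by auto
    then show ?case
      using insert fi by (simp add: assms(5))
  qed (simp add: assms(4))
qed

section \<open>Additive endomorphisms, germs and stalks\<close>

text \<open>
  Scalar multiplication is itself an instance of the following notion, so that on stalks it is
  covered by the lemmas on \<^const>\<open>stalk_map\<close>.
\<close>

definition additive_endo :: "('a, 's) presheaf \<Rightarrow> ('a set \<Rightarrow> 's \<Rightarrow> 's) \<Rightarrow> bool" where
  "additive_endo P \<alpha> \<longleftrightarrow>
     (\<forall>U\<in>opens P. \<alpha> U \<in> carrier (sect P U) \<rightarrow> carrier (sect P U) \<and>
        (\<forall>s\<in>carrier (sect P U). \<forall>t\<in>carrier (sect P U).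
           \<alpha> U (s \<oplus>\<^bsub>sect P U\<^esub> t) = \<alpha> U s \<oplus>\<^bsub>sect P U\<^esub> \<alpha> U t)) \<and>
     (\<forall>U\<in>opens P. \<forall>V\<in>opens P. V \<subseteq> U \<longrightarrow>
        (\<forall>s\<in>carrier (sect P U). \<alpha> V (res P U V s) = res P U V (\<alpha> U s)))"

lemma additive_endoD:
  assumes "additive_endo P \<alpha>" "U \<in> opens P" "s \<in> carrier (sect P U)"
  shows "\<alpha> U s \<in> carrier (sect P U)"
    and "t \<in> carrier (sect P U) \<Longrightarrow> \<alpha> U (s \<oplus>\<^bsub>sect P U\<^esub> t) = \<alpha> U s \<oplus>\<^bsub>sect P U\<^esub> \<alpha> U t"
    and "V \<in> opens P \<Longrightarrow> V \<subseteq> U \<Longrightarrow> \<alpha> V (res P U V s) = res P U V (\<alpha> U s)"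
  using assms unfolding additive_endo_def by blast+

lemma sheaf_endomorphism_imp_additive_endo: "sheaf_endomorphism P \<alpha> \<Longrightarrow> additive_endo P \<alpha>"
  unfolding sheaf_endomorphism_def additive_endo_def by blast

text \<open>The sets in \<open>opens P\<close> need only form a base of \<open>X\<close>, as the
  regular open sets do. Endomorphisms are merely added up and compared with zero, so sections are
  treated as commutative monoids; scalars enter as endomorphisms. The axioms are chosen to hold for
  the sheaf of germs as well, see \<open>abelian_presheaf_Sh\<close>.\<close>

locale abelian_presheaf =
  fixes X :: "'a topology" and P :: "('a, 's) presheaf"
  assumes openin_opens: "U \<in> opens P \<Longrightarrow> openin X U"
    and opens_base: "openin X V \<Longrightarrow> x \<in> V \<Longrightarrow> \<exists>W\<in>opens P. x \<in> W \<and> W \<subseteq> V"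
    and sect_abelian_monoid: "U \<in> opens P \<Longrightarrow> abelian_monoid (sect P U)"
    and res_closed: "U \<in> opens P \<Longrightarrow> V \<in> opens P \<Longrightarrow> V \<subseteq> U \<Longrightarrow> s \<in> carrier (sect P U) \<Longrightarrow>
      res P U V s \<in> carrier (sect P V)"
    and res_zero: "U \<in> opens P \<Longrightarrow> V \<in> opens P \<Longrightarrow> V \<subseteq> U \<Longrightarrow>
      res P U V \<zero>\<^bsub>sect P U\<^esub> = \<zero>\<^bsub>sect P V\<^esub>"
    and res_add: "U \<in> opens P \<Longrightarrow> V \<in> opens P \<Longrightarrow> V \<subseteq> U \<Longrightarrow>
      s \<in> carrier (sect P U) \<Longrightarrow> t \<in> carrier (sect P U) \<Longrightarrow>
      res P U V (s \<oplus>\<^bsub>sect P U\<^esub> t) = res P U V s \<oplus>\<^bsub>sect P V\<^esub> res P U V t"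
    and res_res: "U \<in> opens P \<Longrightarrow> V \<in> opens P \<Longrightarrow> W \<in> opens P \<Longrightarrow> W \<subseteq> V \<Longrightarrow> V \<subseteq> U \<Longrightarrow>
      s \<in> carrier (sect P U) \<Longrightarrow> res P V W (res P U V s) = res P U W s"
begin

text \<open>A base need not be closed under intersection; a common refinement is therefore taken
  around a given point.\<close>

lemma opens_Int:
  assumes "U \<in> opens P" "V \<in> opens P" "x \<in> U" "x \<in> V"
  obtains W where "W \<in> opens P" "x \<in> W" "W \<subseteq> U" "W \<subseteq> V"
  using opens_base[of "U \<inter> V" x] assms openin_opens by (metis Int_iff le_inf_iff openin_Int)

lemmas add_closed = abelian_monoid.a_closed[OF sect_abelian_monoid]
  and zero_closed = abelian_monoid.zero_closed[OF sect_abelian_monoid]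

lemma germ_eqI:
  assumes "U \<in> opens P" "s \<in> carrier (sect P U)" "V \<in> opens P" "t \<in> carrier (sect P V)"
    and "W \<in> opens P" "x \<in> W" "W \<subseteq> U" "W \<subseteq> V" "res P U W s = res P V W t"
  shows "germ P x U s = germ P x V t"
proof -
  \<comment> \<open>One inclusion, for arbitrary representatives that agree on the given
    \<open>W\<close>; exchanging the two representatives yields the other.\<close>
  have *: "germ P x U s \<subseteq> germ P x V t"
    if "U \<in> opens P" "s \<in> carrier (sect P U)" "V \<in> opens P" "t \<in> carrier (sect P V)"
      and "W \<subseteq> U" "W \<subseteq> V" "res P U W s = res P V W t" for U V s t
  proof (clarsimp simp: germ_def)
    fix V' t' W' assume V': "V' \<in> opens P" "x \<in> V'" "t' \<in> carrier (sect P V')"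
      and W': "W' \<in> opens P" "x \<in> W'" "W' \<subseteq> U" "W' \<subseteq> V'" "res P U W' s = res P V' W' t'"
    obtain W'' where W'': "W'' \<in> opens P" "x \<in> W''" "W'' \<subseteq> W" "W'' \<subseteq> W'"
      using opens_Int assms(5,6) W'(1,2) by metis
    have "res P V W'' t = res P W W'' (res P V W t)"
      using that W'' assms(5) by (simp add: res_res)
    also have "\<dots> = res P U W'' s"
      using that W'' assms(5) res_res[of U W W'' s] by simp
    also have "\<dots> = res P W' W'' (res P U W' s)"
      using that W'' W' res_res[of U W' W'' s] by simp
    also have "\<dots> = res P V' W'' t'"
      using V' W'' W' by (simp add: res_res)
    finally show "\<exists>W\<in>opens P. x \<in> W \<and> W \<subseteq> V \<and> W \<subseteq> V' \<and> res P V W t = res P V' W t'"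
      using W'' W' that(6) by blast
  qed
  show ?thesis
    using *[of U s V t] *[of V t U s] assms by auto
qed

lemma germ_self: "U \<in> opens P \<Longrightarrow> x \<in> U \<Longrightarrow> s \<in> carrier (sect P U) \<Longrightarrow> (U, s) \<in> germ P x U s"
  unfolding germ_def by auto

text \<open>The operations on stalks are defined by \<open>THE\<close> over all representatives;
  this fact controls whatever representative may turn up there.\<close>

lemma germ_memD:
  assumes "(V, t) \<in> germ P x U s" "U \<in> opens P" "s \<in> carrier (sect P U)"
  shows "V \<in> opens P" "x \<in> V" "t \<in> carrier (sect P V)" "germ P x V t = germ P x U s"
proof -
  from assms(1) show V: "V \<in> opens P" "x \<in> V" "t \<in> carrier (sect P V)"
    by (auto simp: germ_def)
  from assms(1) obtain W where "W \<in> opens P" "x \<in> W" "W \<subseteq> U" "W \<subseteq> V" "res P U W s = res P V W t"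
    by (auto simp: germ_def)
  with V assms(2,3) show "germ P x V t = germ P x U s"
    by (intro germ_eqI[of _ _ _ _ W]) auto
qed

lemma germ_res:
  assumes "U \<in> opens P" "V \<in> opens P" "V \<subseteq> U" "x \<in> V" "s \<in> carrier (sect P U)"
  shows "germ P x V (res P U V s) = germ P x U s"
  using assms by (intro germ_eqI[of V _ U _ V]) (auto simp: res_closed res_res)

lemma germ_eqD:
  assumes "germ P x U s = germ P x V t" "U \<in> opens P" "x \<in> U" "s \<in> carrier (sect P U)"
  obtains W where "W \<in> opens P" "x \<in> W" "W \<subseteq> U" "W \<subseteq> V" "res P U W s = res P V W t"
proof -
  have "(U, s) \<in> germ P x V t"
    using germ_self[of U x s] assms by simp
  with that show ?thesis
    by (auto simp: germ_def)
qed

lemma carrier_stalk: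
  "carrier (stalk P x) = {germ P x U s | U s. U \<in> opens P \<and> x \<in> U \<and> s \<in> carrier (sect P U)}"
  by (simp add: stalk_def)

lemma germ_in_stalk:
  "U \<in> opens P \<Longrightarrow> x \<in> U \<Longrightarrow> s \<in> carrier (sect P U) \<Longrightarrow> germ P x U s \<in> carrier (stalk P x)"
  by (auto simp: carrier_stalk)

text \<open>Restricting a representative does not change its germ, so it can be taken inside any
  neighbourhood of \<open>x\<close>. This is how a germ at a point off a closed set gets a
  representative over a base set missing that set.\<close>

lemma stalkE:
  assumes "g \<in> carrier (stalk P x)" "openin X V" "x \<in> V"
  obtains U s where "U \<in> opens P" "x \<in> U" "U \<subseteq> V" "s \<in> carrier (sect P U)" "g = germ P x U s"
proof -
  from assms(1) obtain U s where U: "U \<in> opens P" "x \<in> U" "s \<in> carrier (sect P U)" "g = germ P x U s"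
    by (auto simp: carrier_stalk)
  obtain W where W: "W \<in> opens P" "x \<in> W" "W \<subseteq> U \<inter> V"
    using opens_base[of "U \<inter> V" x] openin_opens U assms by blast
  then show ?thesis
    using U by (intro that[of W "res P U W s"]) (auto simp: germ_res res_closed)
qed

lemma stalk_cases:
  assumes "g \<in> carrier (stalk P x)"
  obtains U s where "U \<in> opens P" "x \<in> U" "s \<in> carrier (sect P U)" "g = germ P x U s"
  using assms by (auto simp: carrier_stalk)

lemma stalk2E:
  assumes "g \<in> carrier (stalk P x)" "h \<in> carrier (stalk P x)"
  obtains U s t where "U \<in> opens P" "x \<in> U" "s \<in> carrier (sect P U)" "t \<in> carrier (sect P U)"
    "g = germ P x U s" "h = germ P x U t"
proof -
  obtain V s where V: "V \<in> opens P" "x \<in> V" "s \<in> carrier (sect P V)" "g = germ P x V s"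
    using stalk_cases[OF assms(1)] by metis
  obtain U t where U: "U \<in> opens P" "x \<in> U" "U \<subseteq> V" "t \<in> carrier (sect P U)" "h = germ P x U t"
    using stalkE[OF assms(2) openin_opens[OF V(1)] V(2)] by metis
  with V show ?thesis
    by (intro that[of U "res P V U s" t]) (auto simp: germ_res res_closed)
qed

lemma stalk_zero:
  assumes "U \<in> opens P" "x \<in> U"
  shows "\<zero>\<^bsub>stalk P x\<^esub> = germ P x U \<zero>\<^bsub>sect P U\<^esub>"
  unfolding stalk_def real_module_simps
proof (rule the_equality)
  show "\<exists>V\<in>opens P. x \<in> V \<and> germ P x U \<zero>\<^bsub>sect P U\<^esub> = germ P x V \<zero>\<^bsub>sect P V\<^esub>"
    using assms by blast
  fix k assume "\<exists>V\<in>opens P. x \<in> V \<and> k = germ P x V \<zero>\<^bsub>sect P V\<^esub>"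
  then obtain V where V: "V \<in> opens P" "x \<in> V" "k = germ P x V \<zero>\<^bsub>sect P V\<^esub>"
    by blast
  obtain W where W: "W \<in> opens P" "x \<in> W" "W \<subseteq> U" "W \<subseteq> V"
    using opens_Int assms V by metis
  with V assms show "k = germ P x U \<zero>\<^bsub>sect P U\<^esub>"
    unfolding V(3) by (intro germ_eqI[of _ _ _ _ W]) (auto simp: zero_closed res_zero)
qed

lemma stalk_add:
  assumes "U \<in> opens P" "x \<in> U" "s \<in> carrier (sect P U)" "t \<in> carrier (sect P U)"
  shows "germ P x U s \<oplus>\<^bsub>stalk P x\<^esub> germ P x U t = germ P x U (s \<oplus>\<^bsub>sect P U\<^esub> t)"
  unfolding stalk_def real_module_simps
proof (rule the_equality)
  show "\<exists>V s' t'. (V, s') \<in> germ P x U s \<and> (V, t') \<in> germ P x U t \<and>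
      germ P x U (s \<oplus>\<^bsub>sect P U\<^esub> t) = germ P x V (s' \<oplus>\<^bsub>sect P V\<^esub> t')"
    using germ_self assms by blast
  fix k assume "\<exists>V s' t'. (V, s') \<in> germ P x U s \<and> (V, t') \<in> germ P x U t \<and>
      k = germ P x V (s' \<oplus>\<^bsub>sect P V\<^esub> t')"
  then obtain V s' t' where V: "(V, s') \<in> germ P x U s" "(V, t') \<in> germ P x U t"
    and k: "k = germ P x V (s' \<oplus>\<^bsub>sect P V\<^esub> t')"
    by blast
  note s = germ_memD[OF V(1) assms(1,3)] and t = germ_memD[OF V(2) assms(1,4)]
  obtain W where W: "W \<in> opens P" "x \<in> W" "W \<subseteq> V" "W \<subseteq> U" "res P V W s' = res P U W s"
    using germ_eqD[OF s(4,1-3)] by metis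
  obtain W' where W': "W' \<in> opens P" "x \<in> W'" "W' \<subseteq> V" "W' \<subseteq> U" "res P V W' t' = res P U W' t"
    using germ_eqD[OF t(4,1-3)] by metis
  \<comment> \<open>\<open>s\<close> and \<open>t\<close> agree with their substitutes
    \<open>s'\<close> and \<open>t'\<close> on different neighbourhoods; on \<open>N\<close> both
    agreements hold, so the sums can be compared.\<close>
  obtain N where N: "N \<in> opens P" "x \<in> N" "N \<subseteq> W" "N \<subseteq> W'"
    using opens_Int W W' by metis
  have "res P V N s' = res P U N s"
    using res_res[of V W N s'] res_res[of U W N s] W N s assms by simp
  moreover have "res P V N t' = res P U N t"
    using res_res[of V W' N t'] res_res[of U W' N t] W' N t assms by simp
  ultimately show "k = germ P x U (s \<oplus>\<^bsub>sect P U\<^esub> t)"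
    unfolding k using N W s t assms
    by (intro germ_eqI[of _ _ _ _ N]) (auto simp: add_closed res_add)
qed

text \<open>Each axiom is transported from a base set carrying representatives of all germs
  involved. A point of the space has a base set around it, which supplies the zero germ.\<close>

lemma stalk_abelian_monoid:
  assumes "x \<in> topspace X"
  shows "abelian_monoid (stalk P x)"
proof (rule abelian_monoidI)
  fix g h assume g: "g \<in> carrier (stalk P x)" and h: "h \<in> carrier (stalk P x)"
  from g h show "g \<oplus>\<^bsub>stalk P x\<^esub> h \<in> carrier (stalk P x)"
    by (rule stalk2E) (simp add: stalk_add germ_in_stalk add_closed)
  from g h show "g \<oplus>\<^bsub>stalk P x\<^esub> h = h \<oplus>\<^bsub>stalk P x\<^esub> g"
    by (rule stalk2E) (simp add: stalk_add abelian_monoid.a_comm[OF sect_abelian_monoid])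
  fix k assume k: "k \<in> carrier (stalk P x)"
  obtain V s t where V: "V \<in> opens P" "x \<in> V" "s \<in> carrier (sect P V)" "t \<in> carrier (sect P V)"
    "g = germ P x V s" "h = germ P x V t"
    using stalk2E[OF g h] by metis
  obtain U u where U: "U \<in> opens P" "x \<in> U" "U \<subseteq> V" "u \<in> carrier (sect P U)" "k = germ P x U u"
    using stalkE[OF k openin_opens[OF V(1)] V(2)] by metis
  have gh: "g = germ P x U (res P V U s)" "h = germ P x U (res P V U t)"
    using U V by (simp_all add: germ_res)
  from U V(1-4) show "g \<oplus>\<^bsub>stalk P x\<^esub> h \<oplus>\<^bsub>stalk P x\<^esub> k = g \<oplus>\<^bsub>stalk P x\<^esub> (h \<oplus>\<^bsub>stalk P x\<^esub> k)"
    unfolding gh U(5)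
    by (simp add: stalk_add add_closed res_closed abelian_monoid.a_assoc[OF sect_abelian_monoid])
next
  obtain U where "U \<in> opens P" "x \<in> U"
    using opens_base[of "topspace X" x] assms by blast
  then show "\<zero>\<^bsub>stalk P x\<^esub> \<in> carrier (stalk P x)"
    by (simp add: stalk_zero[of U] germ_in_stalk zero_closed)
next
  fix g assume "g \<in> carrier (stalk P x)"
  then show "\<zero>\<^bsub>stalk P x\<^esub> \<oplus>\<^bsub>stalk P x\<^esub> g = g"
  proof (rule stalk_cases)
    fix U s assume "U \<in> opens P" "x \<in> U" "s \<in> carrier (sect P U)" "g = germ P x U s"
    then show ?thesis
      by (simp add: stalk_zero[of U] stalk_add zero_closed
          abelian_monoid.l_zero[OF sect_abelian_monoid])
  qed
qed

text \<open>Compatibility with restriction makes the germ of \<open>\<alpha> V t\<close> independent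
  of the representative \<open>(V, t)\<close>, so the \<open>THE\<close> in \<open>stalk_map\<close>
  is well defined.\<close>

lemma stalk_map_germ:
  assumes \<alpha>: "additive_endo P \<alpha>" and U: "U \<in> opens P" "x \<in> U" "s \<in> carrier (sect P U)"
  shows "stalk_map P \<alpha> x (germ P x U s) = germ P x U (\<alpha> U s)"
  unfolding stalk_map_def
proof (rule the_equality)
  show "\<exists>V t. (V, t) \<in> germ P x U s \<and> germ P x U (\<alpha> U s) = germ P x V (\<alpha> V t)"
    using germ_self U by blast
  fix k assume "\<exists>V t. (V, t) \<in> germ P x U s \<and> k = germ P x V (\<alpha> V t)"
  then obtain V t where V: "(V, t) \<in> germ P x U s" "k = germ P x V (\<alpha> V t)"
    by blast
  note t = germ_memD[OF V(1) U(1,3)]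
  obtain W where W: "W \<in> opens P" "x \<in> W" "W \<subseteq> V" "W \<subseteq> U" "res P V W t = res P U W s"
    using germ_eqD[OF t(4,1-3)] by metis
  then have "res P V W (\<alpha> V t) = res P U W (\<alpha> U s)"
    using additive_endoD(3)[OF \<alpha>] U t by metis
  with U t W show "k = germ P x U (\<alpha> U s)"
    unfolding V(2) by (intro germ_eqI[of _ _ _ _ W] additive_endoD(1)[OF \<alpha>])
qed

lemma stalk_map_closed:
  assumes "additive_endo P \<alpha>" "g \<in> carrier (stalk P x)"
  shows "stalk_map P \<alpha> x g \<in> carrier (stalk P x)"
  using assms(2)
  by (rule stalk_cases) (simp add: stalk_map_germ assms(1) germ_in_stalk additive_endoD(1))

lemma stalk_map_add:
  assumes "additive_endo P \<alpha>" "g \<in> carrier (stalk P x)" "h \<in> carrier (stalk P x)"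
  shows "stalk_map P \<alpha> x (g \<oplus>\<^bsub>stalk P x\<^esub> h) = stalk_map P \<alpha> x g \<oplus>\<^bsub>stalk P x\<^esub> stalk_map P \<alpha> x h"
  using assms(2,3)
  by (rule stalk2E)
    (simp add: stalk_map_germ assms(1) additive_endoD[OF assms(1)] stalk_add add_closed)

text \<open>Used with scalar multiplication as \<open>\<beta>\<close>, where it turns homogeneity of
  \<open>\<alpha>\<close> on sections into homogeneity on stalks.\<close>

lemma stalk_map_commute:
  assumes "additive_endo P \<alpha>" "additive_endo P \<beta>" "g \<in> carrier (stalk P x)"
    and "\<And>U s. U \<in> opens P \<Longrightarrow> s \<in> carrier (sect P U) \<Longrightarrow> \<alpha> U (\<beta> U s) = \<beta> U (\<alpha> U s)"
  shows "stalk_map P \<alpha> x (stalk_map P \<beta> x g) = stalk_map P \<beta> x (stalk_map P \<alpha> x g)"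
  using assms(3)
  by (rule stalk_cases) (simp add: stalk_map_germ assms additive_endoD(1))

text \<open>Off \<open>C\<close> a germ has a representative over a base set missing
  \<open>C\<close>, which \<open>\<alpha>\<close> annihilates.\<close>

lemma stalk_map_eq_zero:
  assumes "additive_endo P \<alpha>" "closedin X C" "x \<in> topspace X" "x \<notin> C" "g \<in> carrier (stalk P x)"
    and "\<And>U s. U \<in> opens P \<Longrightarrow> U \<inter> C = {} \<Longrightarrow> s \<in> carrier (sect P U) \<Longrightarrow> \<alpha> U s = \<zero>\<^bsub>sect P U\<^esub>"
  shows "stalk_map P \<alpha> x g = \<zero>\<^bsub>stalk P x\<^esub>"
proof (rule stalkE[OF assms(5), of "topspace X - C"])
  fix U s assume "U \<in> opens P" "x \<in> U" "U \<subseteq> topspace X - C" "s \<in> carrier (sect P U)" "g = germ P x U s"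
  moreover from this have "\<alpha> U s = \<zero>\<^bsub>sect P U\<^esub>"
    by (intro assms(6)) auto
  ultimately show ?thesis
    by (simp add: stalk_map_germ assms(1) stalk_zero[of U])
qed (use assms in auto)

lemma finsum_germ:
  assumes "finite I" "U \<in> opens P" "x \<in> U" "\<And>i. i \<in> I \<Longrightarrow> f i \<in> carrier (sect P U)"
  shows "germ P x U (finsum (sect P U) f I) = finsum (stalk P x) (\<lambda>i. germ P x U (f i)) I"
proof (rule finsum_hom)
  show "abelian_monoid (stalk P x)"
    using assms openin_opens openin_subset by (intro stalk_abelian_monoid) blast
qed (use assms in \<open>auto simp: sect_abelian_monoid germ_in_stalk stalk_zero stalk_add\<close>)

text \<open>One representative of \<open>g\<close> serves all \<open>i\<close> at once, so the
  identity is read off from the germ of a sum of sections.\<close>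

lemma finsum_stalk_map:
  assumes "finite I" "\<And>i. i \<in> I \<Longrightarrow> additive_endo P (\<alpha> i)" "g \<in> carrier (stalk P x)"
    and "\<And>U s. U \<in> opens P \<Longrightarrow> s \<in> carrier (sect P U) \<Longrightarrow> finsum (sect P U) (\<lambda>i. \<alpha> i U s) I = s"
  shows "finsum (stalk P x) (\<lambda>i. stalk_map P (\<alpha> i) x g) I = g"
  using assms(3)
proof (rule stalk_cases)
  fix U s assume U: "U \<in> opens P" "x \<in> U" "s \<in> carrier (sect P U)" "g = germ P x U s"
  interpret abelian_monoid "stalk P x"
    using U openin_opens openin_subset by (intro stalk_abelian_monoid) blast
  have "finsum (stalk P x) (\<lambda>i. stalk_map P (\<alpha> i) x g) I
      = finsum (stalk P x) (\<lambda>i. germ P x U (\<alpha> i U s)) I"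
    using U assms(2) by (intro finsum_cong') (auto simp: stalk_map_germ germ_in_stalk additive_endoD(1))
  also have "\<dots> = germ P x U (finsum (sect P U) (\<lambda>i. \<alpha> i U s) I)"
    using U assms(1,2) by (intro finsum_germ[symmetric]) (auto simp: additive_endoD(1))
  finally show ?thesis
    using U assms(4) by simp
qed

section \<open>The sheaf of germs\<close>

abbreviation Sh where "Sh \<equiv> sheafification X P"

lemma opens_Sh: "opens Sh = {W. openin X W}"
  and res_Sh: "res Sh W V \<sigma> = restrict \<sigma> V"
  and zero_Sh: "\<zero>\<^bsub>sect Sh W\<^esub> = (\<lambda>x\<in>W. \<zero>\<^bsub>stalk P x\<^esub>)"
  and add_Sh: "\<sigma> \<oplus>\<^bsub>sect Sh W\<^esub> \<tau> = (\<lambda>x\<in>W. \<sigma> x \<oplus>\<^bsub>stalk P x\<^esub> \<tau> x)"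
  and smult_Sh: "c \<odot>\<^bsub>sect Sh W\<^esub> \<sigma> = (\<lambda>x\<in>W. c \<odot>\<^bsub>stalk P x\<^esub> \<sigma> x)"
  by (simp_all add: sheafification_def)

lemma Sh_sectI:
  assumes "\<sigma> \<in> extensional W"
    and "\<And>x. x \<in> W \<Longrightarrow> \<exists>U\<in>opens P. x \<in> U \<and> U \<subseteq> W \<and>
      (\<exists>s\<in>carrier (sect P U). \<forall>y\<in>U. \<sigma> y = germ P y U s)"
  shows "\<sigma> \<in> carrier (sect Sh W)"
proof -
  have "\<sigma> x \<in> carrier (stalk P x)" if "x \<in> W" for x
    using assms(2)[OF that] germ_in_stalk that by metis
  with assms show ?thesis
    by (auto simp: sheafification_def PiE_def)
qed

lemma Sh_sectD:
  assumes "\<sigma> \<in> carrier (sect Sh W)"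
  shows "\<sigma> \<in> extensional W" "x \<in> W \<Longrightarrow> \<sigma> x \<in> carrier (stalk P x)"
  using assms by (auto simp: sheafification_def PiE_def)

lemma Sh_sectE:
  assumes "\<sigma> \<in> carrier (sect Sh W)" "x \<in> W" "openin X V" "x \<in> V"
  obtains U s where "U \<in> opens P" "x \<in> U" "U \<subseteq> W" "U \<subseteq> V" "s \<in> carrier (sect P U)"
    "\<And>y. y \<in> U \<Longrightarrow> \<sigma> y = germ P y U s"
proof -
  from assms(1,2) obtain U s where U: "U \<in> opens P" "x \<in> U" "U \<subseteq> W" "s \<in> carrier (sect P U)"
    "\<And>y. y \<in> U \<Longrightarrow> \<sigma> y = germ P y U s"
    by (auto simp: sheafification_def)
  obtain N where N: "N \<in> opens P" "x \<in> N" "N \<subseteq> U \<inter> V"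
    using opens_base[of "U \<inter> V" x] openin_opens U assms by blast
  with U show ?thesis
    by (intro that[of N "res P U N s"]) (auto simp: germ_res res_closed)
qed

text \<open>The two sections are induced on possibly different base sets; the one for
  \<open>\<tau>\<close> is taken inside the one for \<open>\<sigma>\<close>, and there the inducing
  sections can be added.\<close>

lemma Sh_sect_closed:
  assumes "\<sigma> \<in> carrier (sect Sh W)" "\<tau> \<in> carrier (sect Sh W)"
  shows "(\<lambda>x\<in>W. \<sigma> x \<oplus>\<^bsub>stalk P x\<^esub> \<tau> x) \<in> carrier (sect Sh W)"
proof (rule Sh_sectI)
  fix x assume x: "x \<in> W"
  obtain U s where U: "U \<in> opens P" "x \<in> U" "U \<subseteq> W" "s \<in> carrier (sect P U)"
    "\<And>y. y \<in> U \<Longrightarrow> \<sigma> y = germ P y U s"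
    using assms(1) x by (auto simp: sheafification_def)
  obtain V t where V: "V \<in> opens P" "x \<in> V" "V \<subseteq> W" "V \<subseteq> U" "t \<in> carrier (sect P V)"
    "\<And>y. y \<in> V \<Longrightarrow> \<tau> y = germ P y V t"
    using Sh_sectE[OF assms(2) x openin_opens[OF U(1)] U(2)] by metis
  have "\<sigma> y = germ P y V (res P U V s)" if "y \<in> V" for y
    using U V that by (auto simp: germ_res)
  then have "\<forall>y\<in>V. (\<lambda>x\<in>W. \<sigma> x \<oplus>\<^bsub>stalk P x\<^esub> \<tau> x) y = germ P y V (res P U V s \<oplus>\<^bsub>sect P V\<^esub> t)"
    using U V by (auto simp: stalk_add res_closed subset_iff)
  with U V show "\<exists>U\<in>opens P. x \<in> U \<and> U \<subseteq> W \<and> (\<exists>s\<in>carrier (sect P U).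
      \<forall>y\<in>U. (\<lambda>x\<in>W. \<sigma> x \<oplus>\<^bsub>stalk P x\<^esub> \<tau> x) y = germ P y U s)"
    by (meson add_closed res_closed)
qed auto

lemma Sh_zero_closed:
  assumes "openin X W"
  shows "(\<lambda>x\<in>W. \<zero>\<^bsub>stalk P x\<^esub>) \<in> carrier (sect Sh W)"
proof (rule Sh_sectI)
  fix x assume "x \<in> W"
  then obtain U where "U \<in> opens P" "x \<in> U" "U \<subseteq> W"
    using opens_base assms by blast
  then show "\<exists>U\<in>opens P. x \<in> U \<and> U \<subseteq> W \<and> (\<exists>s\<in>carrier (sect P U).
      \<forall>y\<in>U. (\<lambda>x\<in>W. \<zero>\<^bsub>stalk P x\<^esub>) y = germ P y U s)"
    by (intro bexI[of _ U] conjI bexI[of _ "\<zero>\<^bsub>sect P U\<^esub>"]) (auto simp: stalk_zero zero_closed)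
qed auto

lemma stalk_monoid_in: "openin X W \<Longrightarrow> x \<in> W \<Longrightarrow> abelian_monoid (stalk P x)"
  by (intro stalk_abelian_monoid) (use openin_subset in blast)

lemma abelian_monoid_Sh:
  assumes "openin X W"
  shows "abelian_monoid (sect Sh W)"
proof -
  note stalk = stalk_monoid_in[OF assms]
  show ?thesis
    by (rule abelian_monoidI; unfold add_Sh zero_Sh; (rule Sh_sect_closed Sh_zero_closed ext)?)
      (auto simp: assms restrict_def abelian_monoid.a_assoc[OF stalk] abelian_monoid.a_comm[OF stalk]
        abelian_monoid.l_zero[OF stalk] Sh_sectD extensional_arb[OF Sh_sectD(1)])
qed

lemma Sh_res_closed:
  assumes "\<sigma> \<in> carrier (sect Sh W)" "openin X V" "V \<subseteq> W"
  shows "restrict \<sigma> V \<in> carrier (sect Sh V)"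
proof (rule Sh_sectI)
  fix x assume x: "x \<in> V"
  with assms(3) have "x \<in> W"
    by (rule subsetD)
  then obtain U s where U: "U \<in> opens P" "x \<in> U" "U \<subseteq> V" "s \<in> carrier (sect P U)"
    "\<And>y. y \<in> U \<Longrightarrow> \<sigma> y = germ P y U s"
    using Sh_sectE[OF assms(1) _ assms(2) x] by metis
  then have "\<forall>y\<in>U. restrict \<sigma> V y = germ P y U s"
    by auto
  with U show "\<exists>U\<in>opens P. x \<in> U \<and> U \<subseteq> V \<and>
      (\<exists>s\<in>carrier (sect P U). \<forall>y\<in>U. restrict \<sigma> V y = germ P y U s)"
    by (intro bexI[of _ U] conjI bexI[of _ s])
qed simp

text \<open>Makes every stalk lemma of the locale available for the stalks of
  \<open>Sh\<close>.\<close>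

lemma abelian_presheaf_Sh: "abelian_presheaf X Sh"
proof (rule abelian_presheaf.intro)
  fix U V :: "'a set" assume UV: "V \<subseteq> U"
  show "res Sh U V \<zero>\<^bsub>sect Sh U\<^esub> = \<zero>\<^bsub>sect Sh V\<^esub>"
    using UV by (simp add: res_Sh zero_Sh inf.absorb2)
  fix s t
  show "res Sh U V (s \<oplus>\<^bsub>sect Sh U\<^esub> t) = res Sh U V s \<oplus>\<^bsub>sect Sh V\<^esub> res Sh U V t"
    unfolding res_Sh add_Sh by (rule ext) (use UV in \<open>simp add: restrict_def subset_iff\<close>)
next
  fix V x assume "openin X V" "x \<in> V"
  then show "\<exists>W\<in>opens Sh. x \<in> W \<and> W \<subseteq> V"
    unfolding opens_Sh by blast
qed (auto simp: opens_Sh res_Sh abelian_monoid_Sh Sh_res_closed inf.absorb2)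

section \<open>Lifting endomorphisms to the sheaf of germs\<close>

definition lift_endo :: "('a set \<Rightarrow> 's \<Rightarrow> 's) \<Rightarrow> 'a set \<Rightarrow> ('a \<Rightarrow> ('a set \<times> 's) set) \<Rightarrow> 'a \<Rightarrow> ('a set \<times> 's) set"
  where "lift_endo \<alpha> W \<sigma> = (\<lambda>x\<in>W. stalk_map P \<alpha> x (\<sigma> x))"

text \<open>Where \<open>\<sigma>\<close> is induced by a presheaf section \<open>s\<close> over
  \<open>U\<close>, its image is induced by \<open>\<alpha> U s\<close>, at all points of
  \<open>U\<close> simultaneously.\<close>

lemma lift_endo_closed:
  assumes \<alpha>: "additive_endo P \<alpha>" and \<sigma>: "\<sigma> \<in> carrier (sect Sh W)"
  shows "lift_endo \<alpha> W \<sigma> \<in> carrier (sect Sh W)"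
proof (rule Sh_sectI)
  fix x assume x: "x \<in> W"
  then obtain U s where U: "U \<in> opens P" "x \<in> U" "U \<subseteq> W" "s \<in> carrier (sect P U)"
    "\<And>y. y \<in> U \<Longrightarrow> \<sigma> y = germ P y U s"
    using \<sigma> by (auto simp: sheafification_def)
  then have "\<forall>y\<in>U. lift_endo \<alpha> W \<sigma> y = germ P y U (\<alpha> U s)"
    by (auto simp: lift_endo_def stalk_map_germ[OF \<alpha>])
  with U show "\<exists>U\<in>opens P. x \<in> U \<and> U \<subseteq> W \<and>
      (\<exists>s\<in>carrier (sect P U). \<forall>y\<in>U. lift_endo \<alpha> W \<sigma> y = germ P y U s)"
    by (intro bexI[of _ U] conjI bexI[of _ "\<alpha> U s"] additive_endoD(1)[OF \<alpha>])
qed (simp add: lift_endo_def)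

text \<open>Both sides unfold to the same \<open>THE\<close>.\<close>

lemma stalk_smult: "c \<odot>\<^bsub>stalk P x\<^esub> g = stalk_map P (\<lambda>U s. c \<odot>\<^bsub>sect P U\<^esub> s) x g"
  by (simp add: stalk_def stalk_map_def)

text \<open>Naturality is immediate because the lift acts pointwise; homogeneity comes from
  \<open>\<alpha>\<close> commuting with scalar multiplication on sections.\<close>

lemma sheaf_endomorphism_lift_endo:
  assumes \<alpha>: "sheaf_endomorphism P \<alpha>"
    and smult: "\<And>c. additive_endo P (\<lambda>U s. c \<odot>\<^bsub>sect P U\<^esub> s)"
  shows "sheaf_endomorphism Sh (lift_endo \<alpha>)"
proof -
  note \<alpha>' = sheaf_endomorphism_imp_additive_endo[OF \<alpha>]
  have "stalk_map P \<alpha> x (c \<odot>\<^bsub>stalk P x\<^esub> g) = c \<odot>\<^bsub>stalk P x\<^esub> stalk_map P \<alpha> x g"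
    if "g \<in> carrier (stalk P x)" for x c g
    unfolding stalk_smult using \<alpha> that
    by (intro stalk_map_commute \<alpha>' smult) (auto simp: sheaf_endomorphism_def)
  then show ?thesis
    unfolding sheaf_endomorphism_def add_Sh smult_Sh res_Sh
    by (intro conjI ballI funcsetI lift_endo_closed[OF \<alpha>'] allI impI)
      (auto simp: lift_endo_def restrict_def fun_eq_iff stalk_map_add[OF \<alpha>'] Sh_sectD)
qed

lemma finsum_Sh:
  assumes "openin X W" "finite I" "\<And>i. i \<in> I \<Longrightarrow> f i \<in> carrier (sect Sh W)" "x \<in> W"
  shows "finsum (sect Sh W) f I x = finsum (stalk P x) (\<lambda>i. f i x) I"
  by (rule finsum_hom[where \<phi> = "\<lambda>\<sigma>. \<sigma> x", OF abelian_monoid_Sh])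
    (use assms in \<open>auto simp: stalk_monoid_in Sh_sectD add_Sh zero_Sh\<close>)

lemma finsum_lift_endo:
  assumes "finite I" "\<And>i. i \<in> I \<Longrightarrow> additive_endo P (\<alpha> i)" "openin X W" "\<sigma> \<in> carrier (sect Sh W)"
    and "\<And>U s. U \<in> opens P \<Longrightarrow> s \<in> carrier (sect P U) \<Longrightarrow> finsum (sect P U) (\<lambda>i. \<alpha> i U s) I = s"
  shows "finsum (sect Sh W) (\<lambda>i. lift_endo (\<alpha> i) W \<sigma>) I = \<sigma>"
proof (rule extensionalityI[of _ W])
  show "finsum (sect Sh W) (\<lambda>i. lift_endo (\<alpha> i) W \<sigma>) I \<in> extensional W"
    using assms by (intro Sh_sectD(1) finsum_closed_if abelian_monoid_Sh lift_endo_closed)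
  fix x assume x: "x \<in> W"
  have "finsum (sect Sh W) (\<lambda>i. lift_endo (\<alpha> i) W \<sigma>) I x
      = finsum (stalk P x) (\<lambda>i. stalk_map P (\<alpha> i) x (\<sigma> x)) I"
    using assms x by (simp add: finsum_Sh lift_endo_closed) (simp add: lift_endo_def)
  also have "\<dots> = \<sigma> x"
    using assms x by (intro finsum_stalk_map) (auto simp: Sh_sectD)
  finally show "finsum (sect Sh W) (\<lambda>i. lift_endo (\<alpha> i) W \<sigma>) I x = \<sigma> x" .
qed (use assms in \<open>auto simp: Sh_sectD\<close>)

text \<open>The premise \<open>partition\<close> is about presheaf sections alone; stalks enter in
  the proof. Its sums run over the indices of nonempty members, since \<open>J\<close> itself may be
  infinite.\<close>

theorem fine_sheafification:
  assumes smult: "\<And>c. additive_endo P (\<lambda>U s. c \<odot>\<^bsub>sect P U\<^esub> s)"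
    and partition: "\<And>(J :: 'i set) U. locally_finite_open_cover X J U \<Longrightarrow>
      \<exists>\<alpha> C. finite {j \<in> J. U j \<noteq> {}} \<and>
        (\<forall>j\<in>J. sheaf_endomorphism P (\<alpha> j) \<and> closedin X (C j) \<and> C j \<subseteq> U j \<and>
          (\<forall>V\<in>opens P. \<forall>s\<in>carrier (sect P V). V \<inter> C j = {} \<longrightarrow> \<alpha> j V s = \<zero>\<^bsub>sect P V\<^esub>)) \<and>
        (\<forall>V\<in>opens P. \<forall>s\<in>carrier (sect P V).
          finsum (sect P V) (\<lambda>j. \<alpha> j V s) {j \<in> J. U j \<noteq> {}} = s)"
  shows "fine_sheaf TYPE('i) X Sh"
  unfolding fine_sheaf_def
proof (intro allI impI)
  fix J :: "'i set" and U assume "locally_finite_open_cover X J U"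
  from partition[OF this] obtain \<alpha> C where fin: "finite {j \<in> J. U j \<noteq> {}}"
    and ball: "\<forall>j\<in>J. sheaf_endomorphism P (\<alpha> j) \<and> closedin X (C j) \<and> C j \<subseteq> U j \<and>
      (\<forall>V\<in>opens P. \<forall>s\<in>carrier (sect P V). V \<inter> C j = {} \<longrightarrow> \<alpha> j V s = \<zero>\<^bsub>sect P V\<^esub>)"
    and sum: "\<forall>V\<in>opens P. \<forall>s\<in>carrier (sect P V).
      finsum (sect P V) (\<lambda>j. \<alpha> j V s) {j \<in> J. U j \<noteq> {}} = s"
    by (elim exE conjE)
  have \<alpha>: "sheaf_endomorphism P (\<alpha> j)" and C: "closedin X (C j)" "C j \<subseteq> U j"
    and zero: "V \<in> opens P \<Longrightarrow> V \<inter> C j = {} \<Longrightarrow> s \<in> carrier (sect P V) \<Longrightarrow>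
      \<alpha> j V s = \<zero>\<^bsub>sect P V\<^esub>" if "j \<in> J" for j V s
    using bspec[OF ball that] by simp_all
  interpret S: abelian_presheaf X Sh
    by (rule abelian_presheaf_Sh)
  note endo = sheaf_endomorphism_imp_additive_endo[OF \<alpha>]
  have lift: "sheaf_endomorphism Sh (lift_endo (\<alpha> j))" if "j \<in> J" for j
    using that by (intro sheaf_endomorphism_lift_endo \<alpha> smult)
  note S_endo = sheaf_endomorphism_imp_additive_endo[OF lift]
  \<comment> \<open>The vanishing criterion is used twice: on the stalks of \<open>P\<close>, to see
    that the lift kills sections over sets missing \<open>C j\<close>, and thereby on the stalks of
    \<open>Sh\<close>.\<close>
  have S_zero: "stalk_map Sh (lift_endo (\<alpha> j)) x g = \<zero>\<^bsub>stalk Sh x\<^esub>"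
    if "j \<in> J" "x \<in> topspace X" "x \<notin> C j" "g \<in> carrier (stalk Sh x)" for j x g
  proof (rule S.stalk_map_eq_zero[OF S_endo C(1)])
    fix W \<sigma> assume W: "W \<in> opens Sh" "W \<inter> C j = {}" "\<sigma> \<in> carrier (sect Sh W)"
    have "stalk_map P (\<alpha> j) y (\<sigma> y) = \<zero>\<^bsub>stalk P y\<^esub>" if "y \<in> W" for y
      using that W \<open>j \<in> J\<close> openin_subset[of X W]
      by (intro stalk_map_eq_zero[OF endo C(1) _ _ _ zero]) (auto simp: opens_Sh Sh_sectD)
    then show "lift_endo (\<alpha> j) W \<sigma> = \<zero>\<^bsub>sect Sh W\<^esub>"
      by (auto simp: lift_endo_def zero_Sh fun_eq_iff)
  qed (use that in auto)
  have "endo_support X Sh (lift_endo (\<alpha> j)) \<subseteq> U j" if "j \<in> J" for j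
  proof -
    \<comment> \<open>\<open>endo_support\<close> is a closure, and it stays inside
      \<open>C j\<close> because \<open>C j\<close> is closed.\<close>
    have "endo_support X Sh (lift_endo (\<alpha> j)) \<subseteq> C j"
      unfolding endo_support_def
    proof (rule closure_of_minimal[OF _ C(1)[OF that]])
      show "{x \<in> topspace X. \<exists>g\<in>carrier (stalk Sh x).
          stalk_map Sh (lift_endo (\<alpha> j)) x g \<noteq> \<zero>\<^bsub>stalk Sh x\<^esub>} \<subseteq> C j"
        using S_zero[OF that] by blast
    qed
    with C(2) that show ?thesis
      by blast
  qed
  moreover have "finsum (stalk Sh x) (\<lambda>j. stalk_map Sh (lift_endo (\<alpha> j)) x g)
      {j \<in> J. stalk_map Sh (lift_endo (\<alpha> j)) x g \<noteq> \<zero>\<^bsub>stalk Sh x\<^esub>} = g"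
    if x: "x \<in> topspace X" and g: "g \<in> carrier (stalk Sh x)" for x g
  proof -
    interpret M: abelian_monoid "stalk Sh x"
      by (rule S.stalk_abelian_monoid[OF x])
    \<comment> \<open>\<open>fine_sheaf\<close> sums over the indices with nonzero term. If
      \<open>U j\<close> is empty then so is \<open>C j\<close>, hence such an index never occurs
      and the sum may be extended by zeros to the finite set of nonempty members.\<close>
    have "stalk_map Sh (lift_endo (\<alpha> j)) x g = \<zero>\<^bsub>stalk Sh x\<^esub>" if j: "j \<in> J" "U j = {}" for j
    proof -
      have "x \<notin> C j"
        using C(2) j by blast
      with j(1) x show ?thesis
        using g by (rule S_zero)
    qed
    moreover have "stalk_map Sh (lift_endo (\<alpha> j)) x g \<in> carrier (stalk Sh x)" if "j \<in> J" for j
      using S_endo[OF that] g by (rule S.stalk_map_closed)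
    ultimately have "finsum (stalk Sh x) (\<lambda>j. stalk_map Sh (lift_endo (\<alpha> j)) x g)
        {j \<in> J. stalk_map Sh (lift_endo (\<alpha> j)) x g \<noteq> \<zero>\<^bsub>stalk Sh x\<^esub>}
      = finsum (stalk Sh x) (\<lambda>j. stalk_map Sh (lift_endo (\<alpha> j)) x g) {j \<in> J. U j \<noteq> {}}"
      by (intro M.add.finprod_mono_neutral_cong_left fin) auto
    also have "\<dots> = g"
    proof (rule S.finsum_stalk_map[OF fin _ g])
      fix W \<sigma> assume "W \<in> opens Sh" "\<sigma> \<in> carrier (sect Sh W)"
      then show "finsum (sect Sh W) (\<lambda>j. lift_endo (\<alpha> j) W \<sigma>) {j \<in> J. U j \<noteq> {}} = \<sigma>"
        using fin endo sum by (intro finsum_lift_endo) (auto simp: opens_Sh)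
    qed (simp add: S_endo)
    finally show ?thesis .
  qed
  ultimately show "\<exists>h. (\<forall>j\<in>J. sheaf_endomorphism Sh (h j) \<and> endo_support X Sh (h j) \<subseteq> U j) \<and>
      (\<forall>x\<in>topspace X. \<forall>g\<in>carrier (stalk Sh x).
        finsum (stalk Sh x) (\<lambda>j. stalk_map Sh (h j) x g)
          {j \<in> J. stalk_map Sh (h j) x g \<noteq> \<zero>\<^bsub>stalk Sh x\<^esub>} = g)"
    using lift by (intro exI[of _ "\<lambda>j. lift_endo (\<alpha> j)"] conjI ballI)
qed

end

section \<open>Piecewise smooth forms\<close>

text \<open>For \<open>y\<close> in \<open>D\<close>, a short initial piece of the segment from
  \<open>x\<close> to \<open>y\<close> lies in \<open>D\<close> by convexity and in \<open>N\<close>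
  by openness; its direction is a positive multiple of \<open>y - x\<close>.\<close>

lemma tangent_open_subset:
  assumes "convex D" "openin (top_of_set D) N" "x \<in> N"
  shows "tangent N x = tangent D x"
proof
  from openin_imp_subset[OF assms(2)] show "tangent N x \<subseteq> tangent D x"
    unfolding tangent_def by (intro span_mono image_mono)
  have "x \<in> D"
    using openin_imp_subset[OF assms(2)] assms(3) by blast
  obtain e where e: "e > 0" "ball x e \<inter> D \<subseteq> N"
    using assms(2,3) unfolding openin_contains_ball by blast
  have "y - x \<in> span ((\<lambda>y. y - x) ` N)" if y: "y \<in> D" for y
  proof -
    \<comment> \<open>The bound 1 keeps the point on the segment, the other bound keeps it within
      distance \<open>e / 2\<close> of \<open>x\<close>; adding 1 in the denominator covers
      \<open>y = x\<close>.\<close>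
    define t where "t = min 1 (e / 2 / (norm (y - x) + 1))"
    have t: "0 < t" "t \<le> 1"
      using e(1) by (auto simp: t_def add_nonneg_pos)
    have "t * norm (y - x) \<le> e / 2 / (norm (y - x) + 1) * norm (y - x)"
      unfolding t_def by (intro mult_right_mono) auto
    also have "\<dots> \<le> e / 2"
      using e(1) by (simp add: divide_simps add_nonneg_pos mult_left_mono)
    finally have "norm (t *\<^sub>R (y - x)) < e"
      using e(1) t by simp
    then have "x + t *\<^sub>R (y - x) \<in> ball x e"
      by (simp add: dist_norm)
    moreover have "x + t *\<^sub>R (y - x) \<in> D"
      using convexD_alt[OF assms(1) \<open>x \<in> D\<close> y, of t] t by (simp add: algebra_simps)
    ultimately have "x + t *\<^sub>R (y - x) \<in> N"
      using e(2) by blast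
    then have "(x + t *\<^sub>R (y - x)) - x \<in> span ((\<lambda>y. y - x) ` N)"
      by (intro span_base imageI)
    then have "(1 / t) *\<^sub>R ((x + t *\<^sub>R (y - x)) - x) \<in> span ((\<lambda>y. y - x) ` N)"
      by (rule span_scale)
    moreover have "(1 / t) *\<^sub>R ((x + t *\<^sub>R (y - x)) - x) = y - x"
      using t by simp
    ultimately show ?thesis
      by metis
  qed
  then show "tangent D x \<subseteq> tangent N x"
    unfolding tangent_def by (intro span_minimal subspace_span) blast
qed

lemma openin_Int_subset:
  assumes "openin (top_of_set M) U" "D \<subseteq> M"
  shows "openin (top_of_set D) (U \<inter> D)"
proof -
  from assms(1) obtain T where "open T" "U = M \<inter> T"
    unfolding openin_open by blast
  with assms(2) have "U \<inter> D = D \<inter> T"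
    by blast
  with \<open>open T\<close> show ?thesis
    by (simp add: openin_open_Int)
qed

section \<open>Forms and their restriction to open subsets\<close>

lemma alg_restrict_simps [simp]:
  "base (alg_restrict A N) = N"
  "fibre (alg_restrict A N) = restr_fibre A N"
  "vadd (alg_restrict A N) = vadd A"
  "vscale (alg_restrict A N) = vscale A"
  "anchor (alg_restrict A N) = anchor A"
  by (simp_all add: alg_restrict_def)

lemma trivs_alg_restrict_subset:
  assumes "(W, r, \<phi>) \<in> trivs (alg_restrict A N)"
  shows "W \<subseteq> N"
  using assms openin_imp_subset by (auto simp: alg_restrict_def)

text \<open>The atlas of \<open>alg_restrict\<close> contains every trivialization that detects
  smoothness of sections, and an open subset of \<open>N\<close> inside \<open>W\<close> is also
  open in \<open>N'\<close>. So a trivialization for \<open>N'\<close> already occurs for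
  \<open>N\<close>, which transfers smoothness of a form from \<open>N\<close> to
  \<open>N'\<close>.\<close>

lemma trivs_alg_restrict_open_subset:
  assumes "openin (top_of_set N) N'" "\<And>x. x \<in> N' \<Longrightarrow> restr_fibre A N' x = restr_fibre A N x"
    and triv: "(W, r, \<phi>) \<in> trivs (alg_restrict A N')"
  shows "(W, r, \<phi>) \<in> trivs (alg_restrict A N)"
proof -
  have W: "openin (top_of_set N') W" "\<And>x. x \<in> W \<Longrightarrow> linear_iso_coords A x (restr_fibre A N' x) r (\<phi> x)"
    and sec: "\<And>V s. openin (top_of_set N') V \<Longrightarrow> V \<subseteq> W \<Longrightarrow> s \<in> (\<Pi>\<^sub>E x\<in>V. restr_fibre A N' x) \<Longrightarrow>
      s \<in> smooth_sections A V \<longleftrightarrow> (\<forall>i<r. smooth_on V (\<lambda>x. \<phi> x (s x) i))"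
    using triv by (auto simp: alg_restrict_def)
  have WN': "W \<subseteq> N'" and N'N: "N' \<subseteq> N"
    using W(1) assms(1) by (auto dest: openin_imp_subset)
  have "openin (top_of_set N) W"
    using W(1) assms(1) by (rule openin_trans)
  moreover have "linear_iso_coords A x (restr_fibre A N x) r (\<phi> x)" if "x \<in> W" for x
    using W(2)[OF that] assms(2)[of x] WN' that by auto
  moreover have "s \<in> smooth_sections A V \<longleftrightarrow> (\<forall>i<r. smooth_on V (\<lambda>x. \<phi> x (s x) i))"
    if "openin (top_of_set N) V" "V \<subseteq> W" "s \<in> (\<Pi>\<^sub>E x\<in>V. restr_fibre A N x)" for V s
  proof (rule sec)
    show "openin (top_of_set N') V"
      using that(1,2) WN' N'N by (intro openin_subset_trans[of N V N']) auto
    have "(\<Pi>\<^sub>E x\<in>V. restr_fibre A N' x) = (\<Pi>\<^sub>E x\<in>V. restr_fibre A N x)"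
      using that(2) WN' assms(2) by (intro PiE_cong) auto
    with that(3) show "s \<in> (\<Pi>\<^sub>E x\<in>V. restr_fibre A N' x)"
      by simp
  qed (rule that(2))
  ultimately show ?thesis
    unfolding alg_restrict_def by simp
qed

lemma formsI:
  assumes "\<And>x vs. \<not> (x \<in> base E \<and> length vs = p \<and> set vs \<subseteq> fibre E x) \<Longrightarrow> \<omega> x vs = 0"
    and "\<And>x vs i v w. x \<in> base E \<Longrightarrow> length vs = p \<Longrightarrow> set vs \<subseteq> fibre E x \<Longrightarrow> i < p \<Longrightarrow>
      v \<in> fibre E x \<Longrightarrow> w \<in> fibre E x \<Longrightarrow>
      \<omega> x (vs[i := vadd E x v w]) = \<omega> x (vs[i := v]) + \<omega> x (vs[i := w])"
    and "\<And>x vs i v c. x \<in> base E \<Longrightarrow> length vs = p \<Longrightarrow> set vs \<subseteq> fibre E x \<Longrightarrow> i < p \<Longrightarrow>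
      v \<in> fibre E x \<Longrightarrow> \<omega> x (vs[i := vscale E x c v]) = c * \<omega> x (vs[i := v])"
    and "\<And>x vs i j. x \<in> base E \<Longrightarrow> length vs = p \<Longrightarrow> set vs \<subseteq> fibre E x \<Longrightarrow> i < p \<Longrightarrow> j < p \<Longrightarrow>
      i \<noteq> j \<Longrightarrow> vs ! i = vs ! j \<Longrightarrow> \<omega> x vs = 0"
    and "\<And>W r \<phi> is. (W, r, \<phi>) \<in> trivs E \<Longrightarrow> length is = p \<Longrightarrow> set is \<subseteq> {..<r} \<Longrightarrow>
      smooth_on W (\<lambda>x. \<omega> x (map (\<lambda>i. local_frame E \<phi> i x) is))"
  shows "\<omega> \<in> forms p E"
  unfolding forms_def mem_Collect_eq
proof (intro conjI ballI allI impI)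
  fix \<tau> assume "\<tau> \<in> trivs E"
  then show "case \<tau> of (W, r, \<phi>) \<Rightarrow> \<forall>is. length is = p \<longrightarrow> set is \<subseteq> {..<r} \<longrightarrow>
      smooth_on W (\<lambda>x. \<omega> x (map (\<lambda>i. local_frame E \<phi> i x) is))"
    using assms(5) by (cases \<tau>) simp
qed (use assms(1-4) in simp_all)

lemma formsD:
  assumes "\<omega> \<in> forms p E"
  shows "\<not> (x \<in> base E \<and> length vs = p \<and> set vs \<subseteq> fibre E x) \<Longrightarrow> \<omega> x vs = 0"
    and "x \<in> base E \<Longrightarrow> length vs = p \<Longrightarrow> set vs \<subseteq> fibre E x \<Longrightarrow> i < p \<Longrightarrow>
      v \<in> fibre E x \<Longrightarrow> w \<in> fibre E x \<Longrightarrow>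
      \<omega> x (vs[i := vadd E x v w]) = \<omega> x (vs[i := v]) + \<omega> x (vs[i := w])"
    and "x \<in> base E \<Longrightarrow> length vs = p \<Longrightarrow> set vs \<subseteq> fibre E x \<Longrightarrow> i < p \<Longrightarrow>
      v \<in> fibre E x \<Longrightarrow> \<omega> x (vs[i := vscale E x c v]) = c * \<omega> x (vs[i := v])"
    and "x \<in> base E \<Longrightarrow> length vs = p \<Longrightarrow> set vs \<subseteq> fibre E x \<Longrightarrow> i < p \<Longrightarrow> j < p \<Longrightarrow>
      i \<noteq> j \<Longrightarrow> vs ! i = vs ! j \<Longrightarrow> \<omega> x vs = 0"
    and "(W, r, \<phi>) \<in> trivs E \<Longrightarrow> length is = p \<Longrightarrow> set is \<subseteq> {..<r} \<Longrightarrow>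
      smooth_on W (\<lambda>x. \<omega> x (map (\<lambda>i. local_frame E \<phi> i x) is))"
proof -
  note * = assms[unfolded forms_def mem_Collect_eq]
  show "\<not> (x \<in> base E \<and> length vs = p \<and> set vs \<subseteq> fibre E x) \<Longrightarrow> \<omega> x vs = 0"
    using * by simp
  note ** = conjunct1[OF conjunct2[OF *], rule_format]
  show "x \<in> base E \<Longrightarrow> length vs = p \<Longrightarrow> set vs \<subseteq> fibre E x \<Longrightarrow> i < p \<Longrightarrow>
      v \<in> fibre E x \<Longrightarrow> w \<in> fibre E x \<Longrightarrow>
      \<omega> x (vs[i := vadd E x v w]) = \<omega> x (vs[i := v]) + \<omega> x (vs[i := w])"
    "x \<in> base E \<Longrightarrow> length vs = p \<Longrightarrow> set vs \<subseteq> fibre E x \<Longrightarrow> i < p \<Longrightarrow>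
      v \<in> fibre E x \<Longrightarrow> \<omega> x (vs[i := vscale E x c v]) = c * \<omega> x (vs[i := v])"
    "x \<in> base E \<Longrightarrow> length vs = p \<Longrightarrow> set vs \<subseteq> fibre E x \<Longrightarrow> i < p \<Longrightarrow> j < p \<Longrightarrow>
      i \<noteq> j \<Longrightarrow> vs ! i = vs ! j \<Longrightarrow> \<omega> x vs = 0"
    using **[of x vs] by simp_all
  show "(W, r, \<phi>) \<in> trivs E \<Longrightarrow> length is = p \<Longrightarrow> set is \<subseteq> {..<r} \<Longrightarrow>
      smooth_on W (\<lambda>x. \<omega> x (map (\<lambda>i. local_frame E \<phi> i x) is))"
    using bspec[OF conjunct2[OF conjunct2[OF *]], of "(W, r, \<phi>)"] by simp
qed

lemma forms_zero: "(\<lambda>x vs. 0) \<in> forms p E"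
  by (rule formsI) (simp_all add: smooth_on_const)

lemma forms_add:
  assumes "\<omega> \<in> forms p E" "\<eta> \<in> forms p E"
  shows "(\<lambda>x vs. \<omega> x vs + \<eta> x vs) \<in> forms p E"
  by (rule formsI)
    (simp_all add: formsD[OF assms(1)] formsD[OF assms(2)] smooth_on_add distrib_left)

lemma forms_mult:
  assumes "\<omega> \<in> forms p E" "\<And>W r \<phi>. (W, r, \<phi>) \<in> trivs E \<Longrightarrow> smooth_on W f"
  shows "(\<lambda>x vs. f x * \<omega> x vs) \<in> forms p E"
  by (rule formsI)
    (simp_all add: formsD[OF assms(1)] smooth_on_mult assms(2) distrib_left)

text \<open>The value is reset to 0 off \<open>N'\<close> because \<open>forms\<close> demands this
  outside the base.\<close>

lemma forms_alg_restrict_open_subset: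
  assumes N': "openin (top_of_set N) N'" "\<And>x. x \<in> N' \<Longrightarrow> restr_fibre A N' x = restr_fibre A N x"
    and \<omega>: "\<omega> \<in> forms p (alg_restrict A N)"
  shows "(\<lambda>x vs. if x \<in> N' then \<omega> x vs else 0) \<in> forms p (alg_restrict A N')"
proof -
  note sub = subsetD[OF openin_imp_subset[OF N'(1)]]
  show ?thesis
  proof (rule formsI)
    fix W r \<phi> and "is" :: "nat list"
    assume triv: "(W, r, \<phi>) \<in> trivs (alg_restrict A N')" and "is": "length is = p" "set is \<subseteq> {..<r}"
    note WN' = subsetD[OF trivs_alg_restrict_subset[OF triv]]
    have "smooth_on W (\<lambda>x. \<omega> x (map (\<lambda>i. local_frame (alg_restrict A N) \<phi> i x) is))"
      using \<omega> trivs_alg_restrict_open_subset[OF N' triv] "is" by (rule formsD(5))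
    \<comment> \<open>A local frame inverts \<open>\<phi> x\<close> on the fibre, so it depends on
      the algebroid through the fibre alone.\<close>
    moreover have "local_frame (alg_restrict A N') \<phi> i x = local_frame (alg_restrict A N) \<phi> i x"
      if "x \<in> W" for i x
      using N'(2)[OF WN'[OF that]] by (simp add: local_frame_def)
    ultimately show "smooth_on W (\<lambda>x. if x \<in> N'
        then \<omega> x (map (\<lambda>i. local_frame (alg_restrict A N') \<phi> i x) is) else 0)"
      using WN' by (subst smooth_on_cong) auto
  next
    fix x vs assume "\<not> (x \<in> base (alg_restrict A N') \<and> length vs = p \<and> set vs \<subseteq> fibre (alg_restrict A N') x)"
    then show "(if x \<in> N' then \<omega> x vs else 0) = 0"
      using formsD(1)[OF \<omega>, of x vs] N'(2)[of x] by auto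
  qed (use N'(2) sub formsD(2-4)[OF \<omega>, unfolded alg_restrict_simps] in simp_all)
qed

lemma form_restrict_zero [simp]: "form_restrict A N (\<lambda>x vs. 0) = (\<lambda>x vs. 0)"
  by (simp add: form_restrict_def)

lemma form_restrict_add:
  "form_restrict A N (\<lambda>x vs. \<omega> x vs + \<eta> x vs) =
    (\<lambda>x vs. form_restrict A N \<omega> x vs + form_restrict A N \<eta> x vs)"
  by (simp add: form_restrict_def fun_eq_iff)

text \<open>Restriction is a pointwise cut-off, hence linear over functions of \<open>x\<close> and
  not just over constants.\<close>

lemma form_restrict_mult:
  "form_restrict A N (\<lambda>x vs. f x * \<omega> x vs) = (\<lambda>x vs. f x * form_restrict A N \<omega> x vs)"
  by (simp add: form_restrict_def fun_eq_iff)

section \<open>Finite simplicial complexes and regular open sets\<close>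

locale finite_complex =
  fixes K :: "'a::euclidean_space set set"
  assumes simplicial_complex: "simplicial_complex K"
begin

lemma simplex:
  assumes "\<Delta> \<in> K"
  shows "convex \<Delta>" "closed \<Delta>" "compact \<Delta>" "polyhedron \<Delta>"
proof -
  obtain n where "n simplex \<Delta>"
    using simplicial_complex assms unfolding simplicial_complex_def by blast
  then show "convex \<Delta>" "closed \<Delta>" "compact \<Delta>" "polyhedron \<Delta>"
    by (auto intro: convex_simplex closed_simplex compact_simplex simplex_imp_polyhedron)
qed

lemma finite_K: "finite K"
  and face_in_K: "\<Delta> \<in> K \<Longrightarrow> F face_of \<Delta> \<Longrightarrow> F \<in> K"
  and Int_face_of: "\<Delta> \<in> K \<Longrightarrow> \<Delta>' \<in> K \<Longrightarrow> \<Delta> \<inter> \<Delta>' face_of \<Delta>"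
  using simplicial_complex unfolding simplicial_complex_def by metis+

text \<open>\<open>\<Delta> \<inter> \<Delta>'\<close> is a face of \<open>\<Delta>\<close>, and a
  face that meets the relative interior is all of \<open>\<Delta>\<close>.\<close>

lemma subset_if_rel_interior:
  assumes "\<Delta> \<in> K" "\<Delta>' \<in> K" "x \<in> rel_interior \<Delta>" "x \<in> \<Delta>'"
  shows "\<Delta> \<subseteq> \<Delta>'"
proof -
  have "x \<in> \<Delta> \<inter> \<Delta>'"
    using assms rel_interior_subset by blast
  then have "\<Delta> \<subseteq> \<Delta> \<inter> \<Delta>'"
    using subset_of_face_of[OF Int_face_of[OF assms(1,2)] subset_refl] assms(3) by blast
  then show ?thesis
    by blast
qed

lemma rel_interior_unique:
  assumes "\<Delta> \<in> K" "\<Delta>' \<in> K" "x \<in> rel_interior \<Delta>" "x \<in> rel_interior \<Delta>'"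
  shows "\<Delta> = \<Delta>'"
  using assms subset_if_rel_interior rel_interior_subset by (metis subsetD subset_antisym)

text \<open>A minimal simplex containing \<open>x\<close> works: otherwise \<open>x\<close> would
  lie in a proper face, again a member of \<open>K\<close>.\<close>

lemma rel_interior_exists:
  assumes "x \<in> \<Union>K"
  shows "\<exists>\<Delta>\<in>K. x \<in> rel_interior \<Delta>"
proof -
  have "finite {\<Delta> \<in> K. x \<in> \<Delta>}" "{\<Delta> \<in> K. x \<in> \<Delta>} \<noteq> {}"
    using finite_K assms by auto
  then obtain \<Delta> where \<Delta>: "\<Delta> \<in> K" "x \<in> \<Delta>"
    and min: "\<And>F. F \<in> K \<Longrightarrow> x \<in> F \<Longrightarrow> F \<subseteq> \<Delta> \<Longrightarrow> F = \<Delta>"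
    using finite_has_minimal[of "{\<Delta> \<in> K. x \<in> \<Delta>}"] by auto
  have "x \<in> rel_interior \<Delta>"
  proof (rule ccontr)
    assume "x \<notin> rel_interior \<Delta>"
    then have "x \<in> rel_frontier \<Delta>"
      using \<Delta> closure_subset by (auto simp: rel_frontier_def)
    then obtain F where "F face_of \<Delta>" "F \<noteq> \<Delta>" "x \<in> F"
      using rel_frontier_of_polyhedron_alt[OF simplex(4)[OF \<Delta>(1)]] by auto
    then show False
      using min face_in_K[OF \<Delta>(1)] face_of_imp_subset by metis
  qed
  with \<Delta>(1) show ?thesis
    by blast
qed

lemma carrier_simplex:
  assumes "x \<in> \<Union>K"
  shows "carrier_simplex K x \<in> K" "x \<in> rel_interior (carrier_simplex K x)"
proof -
  have "\<exists>!\<Delta>. \<Delta> \<in> K \<and> x \<in> rel_interior \<Delta>"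
    using rel_interior_exists[OF assms] rel_interior_unique by blast
  from theI'[OF this] show "carrier_simplex K x \<in> K" "x \<in> rel_interior (carrier_simplex K x)"
    by (simp_all add: carrier_simplex_def)
qed

lemma carrier_simplex_face_of:
  assumes "\<Delta> \<in> K" "x \<in> \<Delta>"
  shows "carrier_simplex K x face_of \<Delta>"
proof -
  note c = carrier_simplex[of x]
  have "carrier_simplex K x \<subseteq> \<Delta>"
    using subset_if_rel_interior[of "carrier_simplex K x" \<Delta> x] assms c by blast
  moreover have "\<Delta> \<inter> carrier_simplex K x face_of \<Delta>"
    using Int_face_of c assms by blast
  ultimately show ?thesis
    by (simp add: inf.absorb2)
qed

text \<open>If \<open>x\<close> is interior to a simplex containing \<open>a\<close>, every simplex
  through \<open>x\<close> contains that simplex and therefore \<open>a\<close>. In this form the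
  star is visibly open, as finitely many closed sets are removed.\<close>

lemma gen_star_eq: "gen_star K a = \<Union>K - \<Union>{\<Delta> \<in> K. a \<notin> \<Delta>}"
proof (intro equalityI subsetI)
  fix x assume "x \<in> gen_star K a"
  then obtain \<Delta> where \<Delta>: "\<Delta> \<in> K" "a \<in> \<Delta>" "x \<in> rel_interior \<Delta>"
    by (auto simp: gen_star_def)
  then show "x \<in> \<Union>K - \<Union>{\<Delta> \<in> K. a \<notin> \<Delta>}"
    using subset_if_rel_interior[of \<Delta> _ x] rel_interior_subset by blast
next
  fix x assume x: "x \<in> \<Union>K - \<Union>{\<Delta> \<in> K. a \<notin> \<Delta>}"
  then have "carrier_simplex K x \<in> K" "x \<in> rel_interior (carrier_simplex K x)"
    by (simp_all add: carrier_simplex)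
  moreover from this have "a \<in> carrier_simplex K x"
    using x rel_interior_subset by blast
  ultimately show "x \<in> gen_star K a"
    by (auto simp: gen_star_def)
qed

lemma openin_gen_star: "openin (realization K) (gen_star K a)"
proof -
  have "closed (\<Union>{\<Delta> \<in> K. a \<notin> \<Delta>})"
    using finite_K simplex(2) by (intro closed_Union) auto
  moreover have "gen_star K a = \<Union>K \<inter> - \<Union>{\<Delta> \<in> K. a \<notin> \<Delta>}"
    unfolding gen_star_eq by blast
  ultimately show ?thesis
    by (simp add: openin_open_Int open_Compl)
qed

lemma regular_open_nbhdD:
  assumes "regular_open_nbhd K a U"
  shows "openin (realization K) U" "U \<subseteq> gen_star K a" "a \<in> U" "a \<in> \<Union>K"
proof -
  from assms obtain Z where Z: "openin (realization K) Z" "a \<in> Z" "U = Z \<inter> gen_star K a"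
    and a: "a \<in> \<Union>K"
    by (auto simp: regular_open_nbhd_def)
  show "openin (realization K) U"
    unfolding Z(3) by (intro openin_Int Z(1) openin_gen_star)
  show "U \<subseteq> gen_star K a" "a \<in> \<Union>K"
    using Z(3) a by auto
  show "a \<in> U"
    using Z a unfolding gen_star_eq by blast
qed

lemma regular_open_nbhd_within:
  assumes "openin (realization K) V" "x \<in> V"
  shows "regular_open_nbhd K x (V \<inter> gen_star K x)"
  using assms openin_imp_subset[OF assms(1)] unfolding regular_open_nbhd_def by blast

abbreviation regular_open where "regular_open U \<equiv> \<exists>a. regular_open_nbhd K a U"

lemma regular_openD: "regular_open U \<Longrightarrow> openin (realization K) U"
  using regular_open_nbhdD(1) by blast

lemma local_simplices_in: "\<Delta> \<in> local_simplices K U \<Longrightarrow> \<Delta> \<in> K"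
  by (simp add: local_simplices_def)

text \<open>The centre \<open>b\<close> of \<open>V\<close> lies in the star of the centre
  \<open>a\<close> of \<open>U\<close>, so the carrier of \<open>b\<close> contains \<open>a\<close>
  and has the carrier of \<open>a\<close> as a face.\<close>

lemma local_simplices_mono:
  assumes "regular_open U" "V \<subseteq> U"
  shows "local_simplices K V \<subseteq> local_simplices K U"
proof
  fix \<Delta> assume "\<Delta> \<in> local_simplices K V"
  then obtain b where \<Delta>: "\<Delta> \<in> K" "regular_open_nbhd K b V" "carrier_simplex K b face_of \<Delta>"
    by (auto simp: local_simplices_def)
  from assms(1) obtain a where a: "regular_open_nbhd K a U"
    by blast
  have b: "b \<in> \<Union>K" "b \<in> gen_star K a"
    using regular_open_nbhdD[OF \<Delta>(2)] regular_open_nbhdD(2)[OF a] assms(2) by auto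
  then obtain \<Delta>' where \<Delta>': "\<Delta>' \<in> K" "a \<in> \<Delta>'" "b \<in> rel_interior \<Delta>'"
    by (auto simp: gen_star_def)
  then have "\<Delta>' = carrier_simplex K b"
    using carrier_simplex[OF b(1)] rel_interior_unique by blast
  then have "carrier_simplex K a face_of \<Delta>"
    using carrier_simplex_face_of[OF \<Delta>'(1,2)] \<Delta>(3) face_of_trans by blast
  with \<Delta>(1) a show "\<Delta> \<in> local_simplices K U"
    by (auto simp: local_simplices_def)
qed

lemma tangent_Int:
  assumes "openin (realization K) U" "convex D" "D \<subseteq> \<Union>K" "x \<in> U \<inter> D"
  shows "tangent (U \<inter> D) x = tangent D x"
  using assms by (intro tangent_open_subset openin_Int_subset)

section \<open>Piecewise smooth forms on derived complexes\<close>

context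
  fixes \<A> :: "'a set \<Rightarrow> ('a, 'e) algebroid" and p :: nat
begin

text \<open>The right-hand side does not mention \<open>U\<close>, since an open piece of a convex
  simplex keeps its tangent spaces. Comparisons between different \<open>U\<close> rest on
  this.\<close>

lemma fibre_derived_complex:
  assumes "openin (realization K) U" "\<Delta> \<in> K" "x \<in> U \<inter> \<Delta>"
  shows "fibre (derived_complex \<A> U \<Delta>) x = {v \<in> fibre (\<A> \<Delta>) x. anchor (\<A> \<Delta>) x v \<in> tangent \<Delta> x}"
proof -
  have "tangent (U \<inter> \<Delta>) x = tangent \<Delta> x"
    using assms simplex(1)[OF assms(2)] by (intro tangent_Int) auto
  then show ?thesis
    by (simp add: derived_complex_def restr_fibre_def)
qed

lemma forms_derived_complex_restrict:
  assumes U: "openin (realization K) U" and V: "openin (realization K) V" "V \<subseteq> U" and "\<Delta> \<in> K"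
    and \<omega>: "\<omega> \<in> forms p (derived_complex \<A> U \<Delta>)"
  shows "(\<lambda>x vs. if x \<in> V then \<omega> x vs else 0) \<in> forms p (derived_complex \<A> V \<Delta>)"
proof -
  have "openin (top_of_set (U \<inter> \<Delta>)) (V \<inter> (U \<inter> \<Delta>))"
    using V(1) \<open>\<Delta> \<in> K\<close> by (intro openin_Int_subset) auto
  moreover have "V \<inter> (U \<inter> \<Delta>) = V \<inter> \<Delta>"
    using V(2) by blast
  ultimately have "openin (top_of_set (U \<inter> \<Delta>)) (V \<inter> \<Delta>)"
    by simp
  moreover have "restr_fibre (\<A> \<Delta>) (V \<inter> \<Delta>) x = restr_fibre (\<A> \<Delta>) (U \<inter> \<Delta>) x" if "x \<in> V \<inter> \<Delta>" for x
    using fibre_derived_complex[OF U \<open>\<Delta> \<in> K\<close>, of x] fibre_derived_complex[OF V(1) \<open>\<Delta> \<in> K\<close> that]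
      that V(2) by (auto simp: derived_complex_def)
  ultimately have "(\<lambda>x vs. if x \<in> V \<inter> \<Delta> then \<omega> x vs else 0) \<in> forms p (derived_complex \<A> V \<Delta>)"
    using \<omega> unfolding derived_complex_def by (rule forms_alg_restrict_open_subset)
  moreover have "\<omega> x vs = 0" if "x \<notin> \<Delta>" for x vs
    using that by (intro formsD(1)[OF \<omega>]) (simp add: derived_complex_def)
  then have "(\<lambda>x vs. if x \<in> V \<inter> \<Delta> then \<omega> x vs else 0) = (\<lambda>x vs. if x \<in> V then \<omega> x vs else 0)"
    by (auto simp: fun_eq_iff)
  ultimately show ?thesis
    by simp
qed

text \<open>The fibres over \<open>V \<inter> \<Delta>\<close> are the full fibres of the algebroid
  on \<open>U \<inter> \<Delta>\<close>, and on other lists of vectors \<open>\<omega>\<close> is 0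
  already, so only the condition on \<open>x\<close> remains visible.\<close>

lemma form_restrict_derived_complex:
  assumes U: "openin (realization K) U" and V: "openin (realization K) V" "V \<subseteq> U" and "\<Delta> \<in> K"
    and \<omega>: "\<omega> \<in> forms p (derived_complex \<A> U \<Delta>)"
  shows "form_restrict (derived_complex \<A> U \<Delta>) (V \<inter> \<Delta>) \<omega> = (\<lambda>x vs. if x \<in> V then \<omega> x vs else 0)"
proof (intro ext)
  fix x vs
  show "form_restrict (derived_complex \<A> U \<Delta>) (V \<inter> \<Delta>) \<omega> x vs = (if x \<in> V then \<omega> x vs else 0)"
  proof (cases "x \<in> V \<inter> \<Delta>")
    case True
    have "tangent (V \<inter> \<Delta>) x = tangent \<Delta> x"
      using V(1) True simplex(1)[OF \<open>\<Delta> \<in> K\<close>] \<open>\<Delta> \<in> K\<close> by (intro tangent_Int) auto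
    moreover have "fibre (derived_complex \<A> U \<Delta>) x =
        {v \<in> fibre (\<A> \<Delta>) x. anchor (\<A> \<Delta>) x v \<in> tangent \<Delta> x}"
      using True V(2) by (intro fibre_derived_complex U \<open>\<Delta> \<in> K\<close>) auto
    ultimately have "fibre (alg_restrict (derived_complex \<A> U \<Delta>) (V \<inter> \<Delta>)) x
        = fibre (derived_complex \<A> U \<Delta>) x"
      by (auto simp: derived_complex_def restr_fibre_def)
    then show ?thesis
      using True formsD(1)[OF \<omega>, of x vs] by (auto simp: form_restrict_def)
  next
    case False
    then show ?thesis
      using formsD(1)[OF \<omega>, of x vs] by (auto simp: form_restrict_def derived_complex_def)
  qed
qed

text \<open>Apart from \<open>x \<in> U\<close> the right-hand side does not involve
  \<open>U\<close>, so agreement of components over \<open>U\<close> can be reused at the points of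
  a smaller set. Two tangency conditions appear because one restriction is applied after
  another.\<close>

lemma form_restrict_face:
  assumes U: "openin (realization K) U" and "\<Delta> \<in> K" "\<Delta>' \<in> K"
  shows "form_restrict (derived_complex \<A> U \<Delta>) ((U \<inter> \<Delta>) \<inter> (U \<inter> \<Delta>')) \<omega> =
    (\<lambda>x vs. if x \<in> U \<inter> \<Delta> \<inter> \<Delta>' \<and> set vs \<subseteq> {v \<in> fibre (\<A> \<Delta>) x.
        anchor (\<A> \<Delta>) x v \<in> tangent \<Delta> x \<and> anchor (\<A> \<Delta>) x v \<in> tangent (\<Delta> \<inter> \<Delta>') x}
      then \<omega> x vs else 0)"
proof -
  have eq: "(U \<inter> \<Delta>) \<inter> (U \<inter> \<Delta>') = U \<inter> (\<Delta> \<inter> \<Delta>')"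
    by blast
  have "fibre (alg_restrict (derived_complex \<A> U \<Delta>) (U \<inter> (\<Delta> \<inter> \<Delta>'))) x = {v \<in> fibre (\<A> \<Delta>) x.
      anchor (\<A> \<Delta>) x v \<in> tangent \<Delta> x \<and> anchor (\<A> \<Delta>) x v \<in> tangent (\<Delta> \<inter> \<Delta>') x}"
    if x: "x \<in> U \<inter> (\<Delta> \<inter> \<Delta>')" for x
  proof -
    have "tangent (U \<inter> (\<Delta> \<inter> \<Delta>')) x = tangent (\<Delta> \<inter> \<Delta>') x"
      using U x assms(2,3) simplex(1) by (intro tangent_Int convex_Int) auto
    moreover have "fibre (derived_complex \<A> U \<Delta>) x =
        {v \<in> fibre (\<A> \<Delta>) x. anchor (\<A> \<Delta>) x v \<in> tangent \<Delta> x}"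
      using x by (intro fibre_derived_complex U \<open>\<Delta> \<in> K\<close>) auto
    ultimately show ?thesis
      by (auto simp: derived_complex_def restr_fibre_def)
  qed
  then show ?thesis
    unfolding eq form_restrict_def by (intro ext if_cong) auto
qed

lemma ps_formsD:
  assumes "\<omega> \<in> ps_forms K \<A> p U"
  shows "\<Delta> \<in> local_simplices K U \<Longrightarrow> \<omega> \<Delta> \<in> forms p (derived_complex \<A> U \<Delta>)"
    and "\<Delta> \<notin> local_simplices K U \<Longrightarrow> \<omega> \<Delta> = (\<lambda>x vs. 0)"
    and "\<Delta> \<in> local_simplices K U \<Longrightarrow> \<Delta>' \<in> local_simplices K U \<Longrightarrow>
      form_restrict (derived_complex \<A> U \<Delta>) ((U \<inter> \<Delta>) \<inter> (U \<inter> \<Delta>')) (\<omega> \<Delta>) =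
      form_restrict (derived_complex \<A> U \<Delta>') ((U \<inter> \<Delta>) \<inter> (U \<inter> \<Delta>')) (\<omega> \<Delta>')"
proof -
  note * = assms[unfolded ps_forms_def mem_Collect_eq]
  show "\<Delta> \<in> local_simplices K U \<Longrightarrow> \<omega> \<Delta> \<in> forms p (derived_complex \<A> U \<Delta>)"
    "\<Delta> \<notin> local_simplices K U \<Longrightarrow> \<omega> \<Delta> = (\<lambda>x vs. 0)"
    using * by simp_all
  show "\<Delta> \<in> local_simplices K U \<Longrightarrow> \<Delta>' \<in> local_simplices K U \<Longrightarrow>
      form_restrict (derived_complex \<A> U \<Delta>) ((U \<inter> \<Delta>) \<inter> (U \<inter> \<Delta>')) (\<omega> \<Delta>) =
      form_restrict (derived_complex \<A> U \<Delta>') ((U \<inter> \<Delta>) \<inter> (U \<inter> \<Delta>')) (\<omega> \<Delta>')"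
    by (rule bspec[OF bspec[OF conjunct2[OF conjunct2[OF *]]]])
qed

text \<open>Reduces identities between piecewise smooth forms to points of \<open>U\<close>, where
  the partition functions are under control.\<close>

lemma ps_forms_eq_0:
  assumes "\<omega> \<in> ps_forms K \<A> p U" "x \<notin> U"
  shows "\<omega> \<Delta> x vs = 0"
proof (cases "\<Delta> \<in> local_simplices K U")
  case True
  show ?thesis
    by (rule formsD(1)[OF ps_formsD(1)[OF assms(1) True]]) (simp add: derived_complex_def assms(2))
qed (simp add: ps_formsD(2)[OF assms(1)])

text \<open>With restriction written as a cut-off in both the simplex and the point, functoriality
  of the presheaf becomes composition of cut-offs.\<close>

lemma ps_form_restrict_eq:
  assumes "regular_open U" "regular_open V" "V \<subseteq> U" "\<omega> \<in> ps_forms K \<A> p U"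
  shows "ps_form_restrict K \<A> U V \<omega> =
    (\<lambda>\<Delta> x vs. if \<Delta> \<in> local_simplices K V \<and> x \<in> V then \<omega> \<Delta> x vs else 0)"
proof
  fix \<Delta>
  show "ps_form_restrict K \<A> U V \<omega> \<Delta> =
      (\<lambda>x vs. if \<Delta> \<in> local_simplices K V \<and> x \<in> V then \<omega> \<Delta> x vs else 0)"
  proof (cases "\<Delta> \<in> local_simplices K V")
    case True
    with assms have "\<omega> \<Delta> \<in> forms p (derived_complex \<A> U \<Delta>)"
      using local_simplices_mono ps_formsD(1) by blast
    with True assms(1-3) show ?thesis
      by (simp add: ps_form_restrict_def form_restrict_derived_complex regular_openD local_simplices_in)
  qed (simp add: ps_form_restrict_def)
qed

lemma ps_form_restrict_closed:
  assumes U: "regular_open U" and V: "regular_open V" "V \<subseteq> U" and \<omega>: "\<omega> \<in> ps_forms K \<A> p U"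
  shows "ps_form_restrict K \<A> U V \<omega> \<in> ps_forms K \<A> p V"
  unfolding ps_form_restrict_eq[OF assms]
  unfolding ps_forms_def mem_Collect_eq
proof (intro conjI ballI allI impI)
  note sub = subsetD[OF local_simplices_mono[OF U V(2)]]
  fix \<Delta> assume \<Delta>: "\<Delta> \<in> local_simplices K V"
  show "(\<lambda>x vs. if \<Delta> \<in> local_simplices K V \<and> x \<in> V then \<omega> \<Delta> x vs else 0)
      \<in> forms p (derived_complex \<A> V \<Delta>)"
    using forms_derived_complex_restrict[OF regular_openD[OF U] regular_openD[OF V(1)] V(2)
        local_simplices_in[OF \<Delta>] ps_formsD(1)[OF \<omega> sub[OF \<Delta>]]] \<Delta> by simp
  fix \<Delta>' assume \<Delta>': "\<Delta>' \<in> local_simplices K V"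
  note face = form_restrict_face[OF _ local_simplices_in[OF \<Delta>] local_simplices_in[OF \<Delta>']]
    form_restrict_face[OF _ local_simplices_in[OF \<Delta>'] local_simplices_in[OF \<Delta>]]
  \<comment> \<open>The intersection is commuted on the right so that both sides match
    \<open>form_restrict_face\<close>, once with \<open>\<Delta>\<close> and
    \<open>\<Delta>'\<close> exchanged.\<close>
  have "form_restrict (derived_complex \<A> U \<Delta>) ((U \<inter> \<Delta>) \<inter> (U \<inter> \<Delta>')) (\<omega> \<Delta>) =
      form_restrict (derived_complex \<A> U \<Delta>') ((U \<inter> \<Delta>') \<inter> (U \<inter> \<Delta>)) (\<omega> \<Delta>')"
    using ps_formsD(3)[OF \<omega> sub[OF \<Delta>] sub[OF \<Delta>']] by (simp only: Int_commute)
  then have eq: "form_restrict (derived_complex \<A> U \<Delta>) ((U \<inter> \<Delta>) \<inter> (U \<inter> \<Delta>')) (\<omega> \<Delta>) x vs =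
      form_restrict (derived_complex \<A> U \<Delta>') ((U \<inter> \<Delta>') \<inter> (U \<inter> \<Delta>)) (\<omega> \<Delta>') x vs" for x vs
    by simp
  have "form_restrict (derived_complex \<A> V \<Delta>) ((V \<inter> \<Delta>) \<inter> (V \<inter> \<Delta>'))
        (\<lambda>x vs. if \<Delta> \<in> local_simplices K V \<and> x \<in> V then \<omega> \<Delta> x vs else 0) =
      form_restrict (derived_complex \<A> V \<Delta>') ((V \<inter> \<Delta>') \<inter> (V \<inter> \<Delta>))
        (\<lambda>x vs. if \<Delta>' \<in> local_simplices K V \<and> x \<in> V then \<omega> \<Delta>' x vs else 0)"
  proof (intro ext)
    fix x vs
    show "form_restrict (derived_complex \<A> V \<Delta>) ((V \<inter> \<Delta>) \<inter> (V \<inter> \<Delta>'))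
        (\<lambda>x vs. if \<Delta> \<in> local_simplices K V \<and> x \<in> V then \<omega> \<Delta> x vs else 0) x vs =
      form_restrict (derived_complex \<A> V \<Delta>') ((V \<inter> \<Delta>') \<inter> (V \<inter> \<Delta>))
        (\<lambda>x vs. if \<Delta>' \<in> local_simplices K V \<and> x \<in> V then \<omega> \<Delta>' x vs else 0) x vs"
    proof (cases "x \<in> V")
      case True
      then have "x \<in> U"
        using V(2) by blast
      \<comment> \<open>At a point of \<open>V\<close> the formulas of
        \<open>form_restrict_face\<close> for \<open>V\<close> and for \<open>U\<close>
        coincide.\<close>
      with True eq[of x vs] \<Delta> \<Delta>' show ?thesis
        unfolding face[OF regular_openD[OF V(1)]] face[OF regular_openD[OF U]]
        by (simp split del: if_split cong: if_cong)
    qed (simp add: form_restrict_def)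
  qed
  then show "form_restrict (derived_complex \<A> V \<Delta>) ((V \<inter> \<Delta>) \<inter> (V \<inter> \<Delta>'))
        (\<lambda>x vs. if \<Delta> \<in> local_simplices K V \<and> x \<in> V then \<omega> \<Delta> x vs else 0) =
      form_restrict (derived_complex \<A> V \<Delta>') ((V \<inter> \<Delta>) \<inter> (V \<inter> \<Delta>'))
        (\<lambda>x vs. if \<Delta>' \<in> local_simplices K V \<and> x \<in> V then \<omega> \<Delta>' x vs else 0)"
    by (simp only: Int_commute)
qed simp

lemma ps_forms_zero: "(\<lambda>\<Delta> x vs. 0) \<in> ps_forms K \<A> p U"
  by (simp add: ps_forms_def forms_zero)

lemma ps_forms_add:
  assumes "\<omega> \<in> ps_forms K \<A> p U" "\<eta> \<in> ps_forms K \<A> p U"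
  shows "(\<lambda>\<Delta> x vs. \<omega> \<Delta> x vs + \<eta> \<Delta> x vs) \<in> ps_forms K \<A> p U"
  unfolding ps_forms_def mem_Collect_eq
proof (intro conjI ballI allI impI)
  fix \<Delta> \<Delta>' assume "\<Delta> \<in> local_simplices K U" "\<Delta>' \<in> local_simplices K U"
  from ps_formsD(3)[OF assms(1) this] ps_formsD(3)[OF assms(2) this]
  show "form_restrict (derived_complex \<A> U \<Delta>) ((U \<inter> \<Delta>) \<inter> (U \<inter> \<Delta>')) (\<lambda>x vs. \<omega> \<Delta> x vs + \<eta> \<Delta> x vs) =
      form_restrict (derived_complex \<A> U \<Delta>') ((U \<inter> \<Delta>) \<inter> (U \<inter> \<Delta>')) (\<lambda>x vs. \<omega> \<Delta>' x vs + \<eta> \<Delta>' x vs)"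
    by (simp only: form_restrict_add)
qed (simp_all add: forms_add ps_formsD(1,2)[OF assms(1)] ps_formsD(1,2)[OF assms(2)])

text \<open>The same \<open>f\<close> multiplies every component, so agreement on common faces
  persists; smoothness on \<open>\<Union>K\<close> restricts to each trivializing set.\<close>

lemma ps_forms_mult:
  assumes "smooth_on (\<Union>K) f" "\<omega> \<in> ps_forms K \<A> p U"
  shows "(\<lambda>\<Delta> x vs. f x * \<omega> \<Delta> x vs) \<in> ps_forms K \<A> p U"
  unfolding ps_forms_def mem_Collect_eq
proof (intro conjI ballI allI impI)
  fix \<Delta> assume \<Delta>: "\<Delta> \<in> local_simplices K U"
  show "(\<lambda>x vs. f x * \<omega> \<Delta> x vs) \<in> forms p (derived_complex \<A> U \<Delta>)"
  proof (rule forms_mult[OF ps_formsD(1)[OF assms(2) \<Delta>]])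
    fix W r \<phi> assume "(W, r, \<phi>) \<in> trivs (derived_complex \<A> U \<Delta>)"
    then have "W \<subseteq> U \<inter> \<Delta>"
      unfolding derived_complex_def by (rule trivs_alg_restrict_subset)
    then show "smooth_on W f"
      using local_simplices_in[OF \<Delta>] by (intro smooth_on_subset[OF assms(1)]) auto
  qed
next
  fix \<Delta> \<Delta>' assume "\<Delta> \<in> local_simplices K U" "\<Delta>' \<in> local_simplices K U"
  from ps_formsD(3)[OF assms(2) this]
  show "form_restrict (derived_complex \<A> U \<Delta>) ((U \<inter> \<Delta>) \<inter> (U \<inter> \<Delta>')) (\<lambda>x vs. f x * \<omega> \<Delta> x vs) =
      form_restrict (derived_complex \<A> U \<Delta>') ((U \<inter> \<Delta>) \<inter> (U \<inter> \<Delta>')) (\<lambda>x vs. f x * \<omega> \<Delta>' x vs)"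
    by (simp only: form_restrict_mult)
qed (simp add: ps_formsD(2)[OF assms(2)])

section \<open>The presheaf and multiplication by smooth functions\<close>

lemma ps_presheaf_simps:
  "opens (ps_presheaf K \<A> p) = {U. regular_open U}"
  "carrier (sect (ps_presheaf K \<A> p) U) = ps_forms K \<A> p U"
  "\<zero>\<^bsub>sect (ps_presheaf K \<A> p) U\<^esub> = (\<lambda>\<Delta> x vs. 0)"
  "\<omega> \<oplus>\<^bsub>sect (ps_presheaf K \<A> p) U\<^esub> \<eta> = (\<lambda>\<Delta> x vs. \<omega> \<Delta> x vs + \<eta> \<Delta> x vs)"
  "c \<odot>\<^bsub>sect (ps_presheaf K \<A> p) U\<^esub> \<omega> = (\<lambda>\<Delta> x vs. c * \<omega> \<Delta> x vs)"
  "res (ps_presheaf K \<A> p) = ps_form_restrict K \<A>"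
  by (simp_all add: ps_presheaf_def)

lemma ps_form_restrict_add:
  "ps_form_restrict K \<A> U V (\<lambda>\<Delta> x vs. \<omega> \<Delta> x vs + \<eta> \<Delta> x vs) =
    (\<lambda>\<Delta> x vs. ps_form_restrict K \<A> U V \<omega> \<Delta> x vs + ps_form_restrict K \<A> U V \<eta> \<Delta> x vs)"
  by (simp add: ps_form_restrict_def form_restrict_add fun_eq_iff)

lemma ps_form_restrict_mult:
  "ps_form_restrict K \<A> U V (\<lambda>\<Delta> x vs. f x * \<omega> \<Delta> x vs) =
    (\<lambda>\<Delta> x vs. f x * ps_form_restrict K \<A> U V \<omega> \<Delta> x vs)"
  by (simp add: ps_form_restrict_def form_restrict_mult fun_eq_iff)

lemma abelian_monoid_ps_forms: "abelian_monoid (sect (ps_presheaf K \<A> p) U)"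
  by (rule abelian_monoidI)
    (simp_all add: ps_presheaf_simps ps_forms_add ps_forms_zero fun_eq_iff algebra_simps)

lemma abelian_presheaf_ps_presheaf: "abelian_presheaf (realization K) (ps_presheaf K \<A> p)"
proof (rule abelian_presheaf.intro; unfold ps_presheaf_simps mem_Collect_eq)
  fix V x assume "openin (realization K) V" "x \<in> V"
  then have "regular_open_nbhd K x (V \<inter> gen_star K x)"
    by (rule regular_open_nbhd_within)
  then have "\<exists>W. regular_open W \<and> x \<in> W \<and> W \<subseteq> V"
    using regular_open_nbhdD(3) by (intro exI[of _ "V \<inter> gen_star K x"]) blast
  then show "\<exists>W\<in>{U. regular_open U}. x \<in> W \<and> W \<subseteq> V"
    by simp
next
  fix U V W \<omega>
  assume U: "regular_open U" and V: "regular_open V" and W: "regular_open W"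
    and sub: "W \<subseteq> V" "V \<subseteq> U" and \<omega>: "\<omega> \<in> ps_forms K \<A> p U"
  have "ps_form_restrict K \<A> V W (ps_form_restrict K \<A> U V \<omega>) = (\<lambda>\<Delta> x vs.
      if \<Delta> \<in> local_simplices K W \<and> x \<in> W then ps_form_restrict K \<A> U V \<omega> \<Delta> x vs else 0)"
    using V W sub(1) ps_form_restrict_closed[OF U V sub(2) \<omega>] by (rule ps_form_restrict_eq)
  \<comment> \<open>Nested cut-offs collapse: simplices local to \<open>W\<close> are local to
    \<open>V\<close>, and points of \<open>W\<close> lie in \<open>V\<close>.\<close>
  also have "\<dots> = (\<lambda>\<Delta> x vs. if \<Delta> \<in> local_simplices K W \<and> x \<in> W then \<omega> \<Delta> x vs else 0)"
    unfolding ps_form_restrict_eq[OF U V sub(2) \<omega>]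
    using subsetD[OF local_simplices_mono[OF V sub(1)]] subsetD[OF sub(1)]
    by (intro ext) simp
  also have "\<dots> = ps_form_restrict K \<A> U W \<omega>"
    using U W subset_trans[OF sub] \<omega> by (rule ps_form_restrict_eq[symmetric])
  finally show "ps_form_restrict K \<A> V W (ps_form_restrict K \<A> U V \<omega>) = ps_form_restrict K \<A> U W \<omega>" .
qed (simp_all add: regular_openD abelian_monoid_ps_forms ps_form_restrict_closed
    ps_form_restrict_add, simp add: ps_form_restrict_def fun_eq_iff)

lemma sheaf_endomorphism_mult:
  assumes "smooth_on (\<Union>K) f"
  shows "sheaf_endomorphism (ps_presheaf K \<A> p) (\<lambda>U \<omega> \<Delta> x vs. f x * \<omega> \<Delta> x vs)"
  unfolding sheaf_endomorphism_def ps_presheaf_simps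
  by (intro conjI ballI allI impI)
    (auto simp: ps_forms_mult[OF assms] ps_form_restrict_mult algebra_simps)

lemma finsum_mult:
  assumes "\<And>i. i \<in> I \<Longrightarrow> smooth_on (\<Union>K) (f i)" "\<omega> \<in> ps_forms K \<A> p U" "finite I"
  shows "finsum (sect (ps_presheaf K \<A> p) U) (\<lambda>i \<Delta> x vs. f i x * \<omega> \<Delta> x vs) I =
    (\<lambda>\<Delta> x vs. (\<Sum>i\<in>I. f i x) * \<omega> \<Delta> x vs)"
proof -
  interpret abelian_monoid "sect (ps_presheaf K \<A> p) U"
    by (rule abelian_monoid_ps_forms)
  show ?thesis
    using assms(3,1)
  proof (induction I rule: finite_induct)
    case (insert i I)
    have "(\<lambda>i \<Delta> x vs. f i x * \<omega> \<Delta> x vs) \<in> I \<rightarrow> carrier (sect (ps_presheaf K \<A> p) U)"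
      "(\<lambda>\<Delta> x vs. f i x * \<omega> \<Delta> x vs) \<in> carrier (sect (ps_presheaf K \<A> p) U)"
      using insert.prems by (auto simp: ps_presheaf_simps intro!: ps_forms_mult assms(2))
    from finsum_insert[OF insert.hyps this] show ?case
      using insert by (simp add: ps_presheaf_simps distrib_right)
  qed (simp add: ps_presheaf_simps)
qed

lemma compact_realization: "compact (\<Union>K)"
  using finite_K simplex(3) by (rule compact_Union)

theorem fine_sheaf_ps_sheaf: "fine_sheaf TYPE('i) (realization K) (ps_sheaf K \<A> p)"
  unfolding ps_sheaf_def
proof (rule abelian_presheaf.fine_sheafification[OF abelian_presheaf_ps_presheaf])
  fix c :: real
  \<comment> \<open>A scalar is a constant function, so this is an instance of
    \<open>sheaf_endomorphism_mult\<close>.\<close>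
  show "additive_endo (ps_presheaf K \<A> p) (\<lambda>U s. c \<odot>\<^bsub>sect (ps_presheaf K \<A> p) U\<^esub> s)"
    using sheaf_endomorphism_imp_additive_endo[OF sheaf_endomorphism_mult[OF smooth_on_const[of _ c]]]
    by (simp add: ps_presheaf_simps)
next
  fix J :: "'i set" and U
  assume cover: "locally_finite_open_cover (realization K) J U"
  let ?J = "{j \<in> J. U j \<noteq> {}}"
  have fin: "finite ?J"
    using cover compact_realization
    by (intro locally_finite_cover_of_compact) (auto simp: compact_space_subtopology)
  have open_U: "openin (realization K) (U j)" if "j \<in> ?J" for j
    using cover that by (simp add: locally_finite_open_cover_def)
  have "\<Union>K = (\<Union>j\<in>J. U j)"
    using cover by (simp add: locally_finite_open_cover_def)
  \<comment> \<open>Discarding the empty members keeps the covering and makes the index set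
    finite.\<close>
  then have cover_U: "\<Union>K \<subseteq> (\<Union>j\<in>?J. U j)"
    by blast
  obtain f :: "'i \<Rightarrow> 'a \<Rightarrow> real" and C
    where f: "\<And>j. smooth_on (\<Union>K) (f j)" and C: "\<And>j. closedin (realization K) (C j)" "\<And>j. C j \<subseteq> U j"
      and zero: "\<And>j x. x \<in> \<Union>K \<Longrightarrow> x \<notin> C j \<Longrightarrow> f j x = 0"
      and sum: "\<And>x. x \<in> \<Union>K \<Longrightarrow> (\<Sum>j\<in>?J. f j x) = 1"
    by (rule smooth_partition_of_unity[OF compact_realization fin open_U cover_U], assumption)
      (rule that)
  let ?\<alpha> = "\<lambda>j U \<omega> \<Delta> x vs. f j x * \<omega> \<Delta> x vs"
  have VK: "x \<in> \<Union>K" if "regular_open V" "x \<in> V" for V x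
    using openin_imp_subset[OF regular_openD[OF that(1)]] that(2) by (rule subsetD)
  \<comment> \<open>On \<open>V\<close> the factor \<open>f j\<close> vanishes because
    \<open>V\<close> misses \<open>C j\<close>; off \<open>V\<close> the form itself does.\<close>
  have mult_0: "(\<lambda>\<Delta> x vs. f j x * \<omega> \<Delta> x vs) = (\<lambda>\<Delta> x vs. 0)"
    if "regular_open V" "\<omega> \<in> ps_forms K \<A> p V" "V \<inter> C j = {}" for j V \<omega>
  proof (intro ext)
    fix \<Delta> x vs
    show "f j x * \<omega> \<Delta> x vs = 0"
    proof (cases "x \<in> V")
      case True
      with that(3) have "x \<notin> C j"
        by blast
      then show ?thesis
        using zero[OF VK[OF that(1) True]] by simp
    qed (simp add: ps_forms_eq_0[OF that(2)])
  qed
  have mult_sum: "(\<lambda>\<Delta> x vs. (\<Sum>j\<in>?J. f j x) * \<omega> \<Delta> x vs) = \<omega>"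
    if "regular_open V" "\<omega> \<in> ps_forms K \<A> p V" for V \<omega>
  proof (intro ext)
    fix \<Delta> x vs
    show "(\<Sum>j\<in>?J. f j x) * \<omega> \<Delta> x vs = \<omega> \<Delta> x vs"
    proof (cases "x \<in> V")
      case True
      then show ?thesis
        using sum[OF VK[OF that(1) True]] by simp
    qed (simp add: ps_forms_eq_0[OF that(2)])
  qed
  show "\<exists>\<alpha> C. finite ?J \<and>
      (\<forall>j\<in>J. sheaf_endomorphism (ps_presheaf K \<A> p) (\<alpha> j) \<and> closedin (realization K) (C j) \<and>
        C j \<subseteq> U j \<and> (\<forall>V\<in>opens (ps_presheaf K \<A> p). \<forall>s\<in>carrier (sect (ps_presheaf K \<A> p) V).
          V \<inter> C j = {} \<longrightarrow> \<alpha> j V s = \<zero>\<^bsub>sect (ps_presheaf K \<A> p) V\<^esub>)) \<and>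
      (\<forall>V\<in>opens (ps_presheaf K \<A> p). \<forall>s\<in>carrier (sect (ps_presheaf K \<A> p) V).
        finsum (sect (ps_presheaf K \<A> p) V) (\<lambda>j. \<alpha> j V s) ?J = s)"
    by (intro exI[of _ ?\<alpha>] exI[of _ C] conjI ballI impI fin sheaf_endomorphism_mult f C)
      (simp_all add: ps_presheaf_simps finsum_mult f fin mult_0 mult_sum)
qed

end

end

theorem theorem3p10:
  fixes K :: "'a::euclidean_space set set"
    and \<A> :: "'a set \<Rightarrow> ('a, 'e) algebroid"
    and p :: nat
  assumes "simplicial_complex K"
    and "lie_algebroid_complex K \<A>"
  shows "fine_sheaf TYPE('i) (realization K) (ps_sheaf K \<A> p)"
  using finite_complex.fine_sheaf_ps_sheaf[OF finite_complex.intro[OF assms(1)]] .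

end
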